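(* The quantum big cell superring $\mathcal{O}_q(U_{12})$ has the following presentation: $$\mathcal{O}_q(U_{12})=\mathbb{C}_q\langle t_{ij},\tilde\tau_{5j}\rangle/I_U,\qquad 3\le i\le 4,\ j=1,2,$$ where $I_U$ is the ideal generated by the relations $$t_{i1}t_{i2}=q\,t_{i2}t_{i1},\quad t_{3j}t_{4j}=q^{-1}t_{4j}t_{3j},\qquad 1\le j\le2,\ 3\le i\le 4,$$ $$t_{31}t_{42}=t_{42}t_{31},\qquad t_{32}t_{41}=t_{41}t_{32}+(q^{-1}-q)t_{42}t_{31},$$ $$\tilde\tau_{51}\tilde\tau_{52}=-q^{-1}\tilde\tau_{52}\tilde\tau_{51},\qquad t_{ij}\tilde\tau_{5j}=q^{-1}\tilde\tau_{5j}t_{ij},\quad 1\le j\le 2,\ 3\le i\le 4,$$ $$t_{i1}\tilde\tau_{52}=\tilde\tau_{52}t_{i1},\qquad t_{i2}\tilde\tau_{51}=\tilde\tau_{51}t_{i2}+(q^{-1}-q)t_{i1}\tilde\tau_{52},\quad 3\le i\le 4.$$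
   Context: Let $\mathbb{C}_q=\mathbb{C}[q,q^{-1}]$. The quantum matrix superalgebra is $M_q(4|1)=\mathbb{C}_q\langle a_{ij}\rangle/I_M$, $1\le i,j\le 5$, where $\mathbb{C}_q\langle a_{ij}\rangle$ is the free algebra on the homogeneous variables $a_{ij}$, $p(i)=0$ for $i\le 4$, $p(5)=1$, $\pi(a_{ij})=p(i)+p(j)$ is the parity of $a_{ij}$, and $I_M$ is the ideal generated by the relations $$a_{ij}a_{il}=(-1)^{\pi(a_{ij})\pi(a_{il})}q^{(-1)^{p(i)+1}}a_{il}a_{ij},\quad j<l,$$ $$a_{ij}a_{kj}=(-1)^{\pi(a_{ij})\pi(a_{kj})}q^{(-1)^{p(j)+1}}a_{kj}a_{ij},\quad i<k,$$ $$a_{ij}a_{kl}=(-1)^{\pi(a_{ij})\pi(a_{kl})}a_{kl}a_{ij},\quad i<k,\ j>l\ \text{ or }\ i>k,\ j<l,$$ $$a_{ij}a_{kl}-(-1)^{\pi(a_{ij})\pi(a_{kl})}a_{kl}a_{ij}=(-1)^{\pi(a_{ij})\pi(a_{kj})}(q^{-1}-q)a_{kj}a_{il},\quad i<k,\ j<l.$$ $\mathcal{O}(\mathrm{GL}_q(4|1))=M_q(4|1)\langle D_1^{-1},D_2^{-1}\rangle$, where $D_1^{-1},D_2^{-1}$ are even two-sided inverses of the quantum determinants $D_1=\sum_{\sigma\in S_4}(-q)^{-l(\sigma)}a_{1\sigma(1)}\cdots a_{4\sigma(4)}$ ($l(\sigma)$ the length of $\sigma$) and $D_2=a_{55}$.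 $\mathcal{O}(P_{l,q})=\mathcal{O}(\mathrm{GL}_q(4|1))/\mathcal{I}_q$, where $\mathcal{I}_q$ is the two-sided ideal generated by $a_{13},a_{14},a_{23},a_{24},a_{15},a_{25}$; this is the Hopf superalgebra of the quantum lower parabolic supergroup. In $\mathcal{O}(P_{l,q})$ denote by the same letters the images of $D_{ij}=a_{i1}a_{j2}-q^{-1}a_{i2}a_{j1}$ ($1\le i<j\le 5$); $D_{12}$ is invertible there. Put $$\begin{pmatrix}t_{31}&t_{32}\\t_{41}&t_{42}\end{pmatrix}=\begin{pmatrix}-q^{-1}D_{23}D_{12}^{-1}&D_{13}D_{12}^{-1}\\-q^{-1}D_{24}D_{12}^{-1}&D_{14}D_{12}^{-1}\end{pmatrix},\qquad (\tilde\tau_{51},\tilde\tau_{52})=(-q^{-1}D_{25}D_{12}^{-1},\,D_{15}D_{12}^{-1}).$$ The quantum big cell $\mathcal{O}_q(U_{12})$ (the quantum chiral Minkowski superspace) is the subring of $\mathcal{O}(P_{l,q})$ generated by the entries of $t$ and $\tilde\tau$. In the presentation, the generators $t_{ij}$ (even) and $\tilde\tau_{5j}$ (odd) correspond to the elements just defined.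
   Formalization: The relations x² = 0 for odd generators x are added both to the ideal defining M_q(4|1) (hence GL_q(4|1) and P_{l,q}) and to I_U; with only the printed relations, (q^{-2} - q^2) τ̃_52² vanishes in the big cell but not in the presented algebra. *)

theory Defs
  imports
    "HOL-Library.Poly_Mapping"
    "HOL-Algebra.QuotRing"
    "HOL-Algebra.Generated_Rings"
    "HOL-Combinatorics.Permutations"
begin

section \<open>Free superalgebras over Laurent polynomials\<close>

text \<open>
  The coefficient ring of Laurent polynomials over the complex numbers is the group algebra of the
  additive group of integers; the monomial with exponent \<open>n\<close> is \<open>qpow n\<close>.
\<close>

type_synonym laurent = "int \<Rightarrow>\<^sub>0 complex"

definition qpow :: "int \<Rightarrow> laurent" where
  "qpow n = Poly_Mapping.single n 1"

text \<open>
  The free monoid, written additively so that the convolution product of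
  \<^theory>\<open>HOL-Library.Poly_Mapping\<close> becomes the product of the free (noncommutative) algebra.
\<close>

datatype 'x free_word = Word (letters: "'x list")

instantiation free_word :: (type) monoid_add
begin

definition zero_free_word :: "'x free_word" where
  "zero_free_word = Word []"

definition plus_free_word :: "'x free_word \<Rightarrow> 'x free_word \<Rightarrow> 'x free_word" where
  "plus_free_word v w = Word (letters v @ letters w)"

instance
  by standard (simp_all add: zero_free_word_def plus_free_word_def)

end

type_synonym 'x free_elt = "'x free_word \<Rightarrow>\<^sub>0 laurent"

definition var :: "'x \<Rightarrow> 'x free_elt" where
  "var x = Poly_Mapping.single (Word [x]) 1"

definition scal :: "laurent \<Rightarrow> 'x free_elt" where
  "scal c = Poly_Mapping.single 0 c"

definition free_alg :: "'x set \<Rightarrow> 'x free_elt ring" where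
  "free_alg X =
    \<lparr>carrier = {f. \<forall>w \<in> Poly_Mapping.keys f. set (letters w) \<subseteq> X},
     monoid.mult = (*), one = 1, zero = 0, add = (+)\<rparr>"

text \<open>
  Generators are homogeneous: \<open>par x\<close> is a natural number whose class modulo 2 is the parity of
  \<open>x\<close>, and the parity of a word is the sum of the parities of its letters.
\<close>

definition free_part :: "'x set \<Rightarrow> ('x \<Rightarrow> nat) \<Rightarrow> nat \<Rightarrow> 'x free_elt set" where
  "free_part X par k =
    {f \<in> carrier (free_alg X).
       \<forall>w \<in> Poly_Mapping.keys f. sum_list (map par (letters w)) mod 2 = k mod 2}"

text \<open>
  Convention: in a superalgebra presented by homogeneous generators, odd generators square to
  zero. It is built into \<open>pres_ideal\<close>, hence applies in the same way to the quantum matrix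
  superalgebra and to the quantum big cell. It cannot be dropped. With only the commutation
  relations listed below, reordering \<open>a\<^sub>1\<^sub>1 a\<^sub>5\<^sub>1 a\<^sub>5\<^sub>2\<close> in two ways shows that \<open>q\<^sup>2 - q\<^sup>-\<^sup>2\<close>
  annihilates \<open>a\<^sub>5\<^sub>1\<^sup>2 a\<^sub>1\<^sub>2\<close>. The analogous computations, together with the invertibility of the
  quantum determinants, show that \<open>q\<^sup>2 - q\<^sup>-\<^sup>2\<close> annihilates the squares of \<open>a\<^sub>5\<^sub>1\<close>, \<open>a\<^sub>5\<^sub>2\<close> and of
  \<open>D\<^sub>1\<^sub>5 D\<^sub>1\<^sub>2\<^sup>-\<^sup>1\<close>, whereas the commutation relations of the big cell put no condition on the square
  of its second odd generator.
\<close>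

definition odd_squares :: "'x set \<Rightarrow> ('x \<Rightarrow> nat) \<Rightarrow> 'x free_elt set" where
  "odd_squares X par = {var x * var x | x. x \<in> X \<and> odd (par x)}"

definition pres_ideal :: "'x set \<Rightarrow> ('x \<Rightarrow> nat) \<Rightarrow> 'x free_elt set \<Rightarrow> 'x free_elt set" where
  "pres_ideal X par R = genideal (free_alg X) (odd_squares X par \<union> R)"

definition pres_alg :: "'x set \<Rightarrow> ('x \<Rightarrow> nat) \<Rightarrow> 'x free_elt set \<Rightarrow> 'x free_elt set ring" where
  "pres_alg X par R = free_alg X Quot pres_ideal X par R"

definition pres_class ::
  "'x set \<Rightarrow> ('x \<Rightarrow> nat) \<Rightarrow> 'x free_elt set \<Rightarrow> 'x free_elt \<Rightarrow> 'x free_elt set" where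
  "pres_class X par R f = pres_ideal X par R +>\<^bsub>free_alg X\<^esub> f"


section \<open>The quantum general linear supergroup\<close>

text \<open>\<open>Ent i j\<close> is the matrix entry in row \<open>i\<close> and column \<open>j\<close>.\<close>

datatype gl_gen = Ent nat nat | Det1inv | Det2inv

definition idx_par :: "nat \<Rightarrow> nat" where
  "idx_par i = (if i = 5 then 1 else 0)"

fun gl_par :: "gl_gen \<Rightarrow> nat" where
  "gl_par (Ent i j) = (idx_par i + idx_par j) mod 2"
| "gl_par Det1inv = 0"
| "gl_par Det2inv = 0"

definition gl_gens :: "gl_gen set" where
  "gl_gens = {Ent i j | i j. i \<in> {1..5} \<and> j \<in> {1..5}} \<union> {Det1inv, Det2inv}"

abbreviation ent :: "nat \<Rightarrow> nat \<Rightarrow> gl_gen free_elt" where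
  "ent i j \<equiv> var (Ent i j)"

definition super_sign :: "gl_gen \<Rightarrow> gl_gen \<Rightarrow> laurent" where
  "super_sign x y = (- 1) ^ (gl_par x * gl_par y)"

text \<open>A relation \<open>f = g\<close> is encoded as the element \<open>f - g\<close>.\<close>

definition matrix_rels :: "gl_gen free_elt set" where
  "matrix_rels =
    {ent i j * ent i l
       - scal (super_sign (Ent i j) (Ent i l) * qpow ((- 1) ^ (idx_par i + 1))) * ent i l * ent i j
     | i j l. i \<in> {1..5} \<and> j \<in> {1..5} \<and> l \<in> {1..5} \<and> j < l} \<union>
    {ent i j * ent k j
       - scal (super_sign (Ent i j) (Ent k j) * qpow ((- 1) ^ (idx_par j + 1))) * ent k j * ent i j
     | i j k. i \<in> {1..5} \<and> j \<in> {1..5} \<and> k \<in> {1..5} \<and> i < k} \<union>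
    {ent i j * ent k l - scal (super_sign (Ent i j) (Ent k l)) * ent k l * ent i j
     | i j k l. i \<in> {1..5} \<and> j \<in> {1..5} \<and> k \<in> {1..5} \<and> l \<in> {1..5} \<and>
         (i < k \<and> j > l \<or> i > k \<and> j < l)} \<union>
    {ent i j * ent k l - scal (super_sign (Ent i j) (Ent k l)) * ent k l * ent i j
       - scal (super_sign (Ent i j) (Ent k j) * (qpow (- 1) - qpow 1)) * ent k j * ent i l
     | i j k l. i \<in> {1..5} \<and> j \<in> {1..5} \<and> k \<in> {1..5} \<and> l \<in> {1..5} \<and> i < k \<and> j < l}"

definition perm_length :: "(nat \<Rightarrow> nat) \<Rightarrow> nat" where
  "perm_length s = card {(i, j). i \<in> {1..4} \<and> j \<in> {1..4} \<and> i < j \<and> s i > s j}"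

text \<open>The coefficient below is the power of \<open>- q\<close> with exponent \<open>- perm_length s\<close>.\<close>

definition qdet1 :: "gl_gen free_elt" where
  "qdet1 =
    (\<Sum>s | s permutes {1..4}.
       scal ((- 1) ^ perm_length s * qpow (- int (perm_length s))) *
       ent 1 (s 1) * ent 2 (s 2) * ent 3 (s 3) * ent 4 (s 4))"

definition qdet2 :: "gl_gen free_elt" where
  "qdet2 = ent 5 5"

definition inverse_rels :: "gl_gen free_elt set" where
  "inverse_rels =
    {qdet1 * var Det1inv - 1, var Det1inv * qdet1 - 1,
     qdet2 * var Det2inv - 1, var Det2inv * qdet2 - 1}"

text \<open>
  Adjoining two-sided inverses to the quantum matrix superalgebra amounts to adjoining two even
  free generators together with the relations \<open>inverse_rels\<close>.
\<close>

definition O_GL :: "gl_gen free_elt set ring" where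
  "O_GL = pres_alg gl_gens gl_par (matrix_rels \<union> inverse_rels)"

definition to_GL :: "gl_gen free_elt \<Rightarrow> gl_gen free_elt set" where
  "to_GL f = pres_class gl_gens gl_par (matrix_rels \<union> inverse_rels) f"


section \<open>The quantum lower parabolic supergroup and its big cell\<close>

definition parabolic_ideal :: "gl_gen free_elt set set" where
  "parabolic_ideal =
    genideal O_GL (to_GL ` {ent 1 3, ent 1 4, ent 2 3, ent 2 4, ent 1 5, ent 2 5})"

definition O_P :: "gl_gen free_elt set set ring" where
  "O_P = O_GL Quot parabolic_ideal"

definition to_P :: "gl_gen free_elt \<Rightarrow> gl_gen free_elt set set" where
  "to_P f = parabolic_ideal +>\<^bsub>O_GL\<^esub> to_GL f"

definition qminor :: "nat \<Rightarrow> nat \<Rightarrow> gl_gen free_elt" where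
  "qminor i j = ent i 1 * ent j 2 - scal (qpow (- 1)) * ent i 2 * ent j 1"

text \<open>
  \<open>Tgen i j\<close> and \<open>Taugen j\<close> are the even and odd generators of the presentation,
  \<open>big_cell_elt\<close> gives the corresponding elements of \<open>O_P\<close>.
\<close>

datatype cell_gen = Tgen nat nat | Taugen nat

fun cell_par :: "cell_gen \<Rightarrow> nat" where
  "cell_par (Tgen i j) = 0"
| "cell_par (Taugen j) = 1"

definition cell_gens :: "cell_gen set" where
  "cell_gens = {Tgen i j | i j. i \<in> {3, 4} \<and> j \<in> {1, 2}} \<union> {Taugen j | j. j \<in> {1, 2}}"

definition cell_coord :: "nat \<Rightarrow> nat \<Rightarrow> gl_gen free_elt set set" where
  "cell_coord i j =
    (if j = 1 then to_P (- scal (qpow (- 1)) * qminor 2 i) else to_P (qminor 1 i))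
      \<otimes>\<^bsub>O_P\<^esub> inv\<^bsub>O_P\<^esub> to_P (qminor 1 2)"

fun big_cell_elt :: "cell_gen \<Rightarrow> gl_gen free_elt set set" where
  "big_cell_elt (Tgen i j) = cell_coord i j"
| "big_cell_elt (Taugen j) = cell_coord 5 j"

text \<open>The subring generated over the Laurent polynomials, i.e. scalars are included.\<close>

definition O_U12 :: "gl_gen free_elt set set ring" where
  "O_U12 = O_P\<lparr>carrier :=
     generate_ring O_P (range (\<lambda>c. to_P (scal c)) \<union> big_cell_elt ` cell_gens)\<rparr>"

abbreviation tv :: "nat \<Rightarrow> nat \<Rightarrow> cell_gen free_elt" where
  "tv i j \<equiv> var (Tgen i j)"

abbreviation tauv :: "nat \<Rightarrow> cell_gen free_elt" where
  "tauv j \<equiv> var (Taugen j)"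

definition cell_rels :: "cell_gen free_elt set" where
  "cell_rels =
    {tv i 1 * tv i 2 - scal (qpow 1) * tv i 2 * tv i 1 | i. i \<in> {3, 4}} \<union>
    {tv 3 j * tv 4 j - scal (qpow (- 1)) * tv 4 j * tv 3 j | j. j \<in> {1, 2}} \<union>
    {tv 3 1 * tv 4 2 - tv 4 2 * tv 3 1,
     tv 3 2 * tv 4 1 - (tv 4 1 * tv 3 2 + scal (qpow (- 1) - qpow 1) * tv 4 2 * tv 3 1),
     tauv 1 * tauv 2 + scal (qpow (- 1)) * tauv 2 * tauv 1} \<union>
    {tv i j * tauv j - scal (qpow (- 1)) * tauv j * tv i j | i j. i \<in> {3, 4} \<and> j \<in> {1, 2}} \<union>
    {tv i 1 * tauv 2 - tauv 2 * tv i 1 | i. i \<in> {3, 4}} \<union>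
    {tv i 2 * tauv 1 - (tauv 1 * tv i 2 + scal (qpow (- 1) - qpow 1) * tv i 1 * tauv 2)
     | i. i \<in> {3, 4}}"

end

theory Submission
  imports Defs
begin

text \<open>
  The minors \<open>D\<^sub>i\<^sub>j\<close> involve only the first two columns of the quantum matrix, and straightening
  words in these columns shows that the elements \<open>t\<^sub>i\<^sub>j\<close> and \<open>\<tau>\<^sub>5\<^sub>j\<close> satisfy the relations of the big
  cell; \<open>D\<^sub>1\<^sub>2\<close> is invertible because \<open>D\<^sub>1\<close> is the product of the two commuting diagonal block minors
  as soon as the upper right block vanishes. In the presented algebra the same kind of
  straightening shows that the ordered monomials
  \<open>t\<^sub>3\<^sub>2\<^sup>a t\<^sub>4\<^sub>2\<^sup>b \<tau>\<^sub>5\<^sub>2\<^sup>f t\<^sub>3\<^sub>1\<^sup>c t\<^sub>4\<^sub>1\<^sup>d \<tau>\<^sub>5\<^sub>1\<^sup>e\<close> with \<open>e, f \<le> 1\<close> span. It remains to see that the images of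
  these monomials are linearly independent over the Laurent polynomials. For this, the parabolic
  algebra is represented on functions on a lattice: the product of seven elementary lower
  bidiagonal quantum matrices whose entries generate supercommuting quantum tori is again a quantum
  matrix, it is lower triangular, and each generator of the big cell acts by a unique leading
  shift plus shifts of smaller height. Distinct monomials have distinct leading shifts.
\<close>

section \<open>Evaluation of free superalgebras\<close>

text \<open>The obstacle is independence: reordering words in a quotient shows that monomials span,
  never that no further relation holds. A concrete module settles this, because there the defining
  relations can be checked and a vanishing combination can be tested on one vector. That a product
  of quantum matrices with supercommuting entries is again a quantum matrix reflects the
  multiplicativity of the comultiplication. The leading coefficients are plus or minus powers of q,
  so the argument works over the Laurent polynomials themselves, without inverting anything. Carrier
  conditions would obstruct the long rewriting of words. Therefore both quotient rings are copied to
  types, and all computation takes place in the locale \<open>central_scalars\<close>, which is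
  interpreted for the free algebra, the operators, the parabolic algebra and the presented algebra.
  Elements are written as evaluations of free words, which is how an identity is carried from one
  ring to another.\<close>

lemma poly_mapping_sum_monomials:
  "(\<Sum>k\<in>Poly_Mapping.keys f. Poly_Mapping.single k (Poly_Mapping.lookup f k)) = f"
  by (rule poly_mapping_eqI)
    (simp add: lookup_sum lookup_single when_def sum.delta' in_keys_iff)

lemma qpow_mult: "qpow m * qpow n = qpow (m + n)"
  by (simp add: qpow_def mult_single)

lemma qpow_0: "qpow 0 = 1"
  by (simp add: qpow_def)

text \<open>
  The sort leaves out \<open>0 \<noteq> 1\<close>, which is not known in advance for the quotient algebras to which the
  locale is applied.
\<close>

locale central_scalars =
  fixes C :: "laurent \<Rightarrow> 'a::{ring, monoid_mult}"
  assumes C_1: "C 1 = 1"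
    and C_add: "C (c + d) = C c + C d"
    and C_mult: "C (c * d) = C c * C d"
    and C_commute: "C c * x = x * C c"
begin

definition Q :: "int \<Rightarrow> 'a" where
  "Q n = C (qpow n)"

lemma C_0 [simp]: "C 0 = 0"
  using C_add[of 0 0] by simp

lemma C_minus: "C (- c) = - C c"
  using C_add[of c "- c"] by (simp add: minus_unique)

lemma C_diff: "C (c - d) = C c - C d"
  using C_add[of c "- d"] by (simp add: C_minus)

lemma Q_0 [simp]: "Q 0 = 1"
  by (simp add: Q_def qpow_0 C_1)

lemma Q_mult: "Q m * Q n = Q (m + n)"
  by (simp add: Q_def qpow_mult flip: C_mult)

lemma Q_mult_left: "Q m * (Q n * x) = Q (m + n) * x"
  by (simp add: Q_mult flip: mult.assoc)

lemma Q_commute: "x * Q n = Q n * x"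
  by (simp add: Q_def C_commute)

lemma Q_left_commute: "x * (Q n * y) = Q n * (x * y)"
  by (metis Q_commute mult.assoc)

text \<open>The family \<open>N\<close> is arbitrary so that words (in \<open>ev\<close>) and
  exponent vectors (in \<open>cell_mono\<close>) share one theory of linear combinations.\<close>

definition lin_comb :: "('k \<Rightarrow> 'a) \<Rightarrow> ('k \<Rightarrow>\<^sub>0 laurent) \<Rightarrow> 'a" where
  "lin_comb N f = (\<Sum>n\<in>Poly_Mapping.keys f. C (Poly_Mapping.lookup f n) * N n)"

lemma lin_comb_0 [simp]: "lin_comb N 0 = 0"
  by (simp add: lin_comb_def)

lemma lin_comb_single: "lin_comb N (Poly_Mapping.single n c) = C c * N n"
  by (cases "c = 0") (simp_all add: lin_comb_def)

lemma lin_comb_add: "lin_comb N (f + g) = lin_comb N f + lin_comb N g"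
  unfolding lin_comb_def by (rule setsum_keys_plus_distrib) (simp_all add: C_add distrib_right)

lemma lin_comb_sum: "lin_comb N (\<Sum>i\<in>S. f i) = (\<Sum>i\<in>S. lin_comb N (f i))"
  by (induction S rule: infinite_finite_induct) (simp_all add: lin_comb_add)

lemma lin_comb_minus: "lin_comb N (- f) = - lin_comb N f"
  using lin_comb_add[of N f "- f"] by (simp add: minus_unique)

lemma lin_comb_diff: "lin_comb N (f - g) = lin_comb N f - lin_comb N g"
  using lin_comb_add[of N f "- g"] by (simp add: lin_comb_minus)

definition ev :: "('x \<Rightarrow> 'a) \<Rightarrow> 'x free_elt \<Rightarrow> 'a" where
  "ev g = lin_comb (\<lambda>w. prod_list (map g (letters w)))"

lemma ev_0 [simp]: "ev g 0 = 0"
  by (simp add: ev_def)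

lemma ev_add: "ev g (f + h) = ev g f + ev g h"
  by (simp add: ev_def lin_comb_add)

lemma ev_sum: "ev g (\<Sum>i\<in>S. f i) = (\<Sum>i\<in>S. ev g (f i))"
  by (simp add: ev_def lin_comb_sum)

lemma ev_minus: "ev g (- f) = - ev g f"
  by (simp add: ev_def lin_comb_minus)

lemma ev_diff: "ev g (f - h) = ev g f - ev g h"
  by (simp add: ev_def lin_comb_diff)

lemma ev_single: "ev g (Poly_Mapping.single w c) = C c * prod_list (map g (letters w))"
  by (simp add: ev_def lin_comb_single)

lemma ev_scal: "ev g (scal c) = C c"
  by (simp add: scal_def ev_single zero_free_word_def)

lemma ev_1 [simp]: "ev g 1 = 1"
  using ev_scal[of g 1] by (simp add: scal_def C_1)

lemma ev_var: "ev g (var x) = g x"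
  by (simp add: var_def ev_single C_1)

text \<open>Additivity reduces the claim to monomials; there the centrality of \<open>C\<close>
  moves the second coefficient past the first word.\<close>

lemma ev_mult: "ev g (f * h) = ev g f * ev g h"
proof -
  have single: "ev g (Poly_Mapping.single v c * Poly_Mapping.single w d) =
      ev g (Poly_Mapping.single v c) * ev g (Poly_Mapping.single w d)" for v w c d
    by (simp add: mult_single ev_single C_mult plus_free_word_def mult.assoc)
       (metis C_commute mult.assoc)
  show ?thesis
    by (subst (1 2) poly_mapping_sum_monomials[of f, symmetric],
        subst (1 2) poly_mapping_sum_monomials[of h, symmetric])
       (simp add: sum_product ev_sum single)
qed

lemma ev_power: "ev g (f ^ n) = ev g f ^ n"
  by (induction n) (simp_all add: ev_mult)

end

section \<open>Minors of the first two columns\<close>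

lemma mult_assoc_rule: "x * y = z \<Longrightarrow> x * (y * w) = z * (w::'a::semigroup_mult)"
  by (metis mult.assoc)

context central_scalars
begin

text \<open>
  \<open>row_pair a b c d\<close> holds for the first two entries \<open>a, b\<close> of an even row and the first two entries
  \<open>c, d\<close> of any later row. No signs occur, because \<open>a\<close> and \<open>b\<close> are even.
\<close>

definition row_pair :: "'a \<Rightarrow> 'a \<Rightarrow> 'a \<Rightarrow> 'a \<Rightarrow> bool" where
  "row_pair a b c d \<longleftrightarrow>
     a * c = Q (- 1) * (c * a) \<and> b * d = Q (- 1) * (d * b) \<and> b * c = c * b \<and>
     a * d - d * a = (Q (- 1) - Q 1) * (c * b)"

definition even_row :: "'a \<Rightarrow> 'a \<Rightarrow> bool" where
  "even_row a b \<longleftrightarrow> a * b = Q (- 1) * (b * a)"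

definition odd_row :: "'a \<Rightarrow> 'a \<Rightarrow> bool" where
  "odd_row a b \<longleftrightarrow> a * b = - (Q 1 * (b * a)) \<and> a * a = 0 \<and> b * b = 0"

definition minor :: "'a \<Rightarrow> 'a \<Rightarrow> 'a \<Rightarrow> 'a \<Rightarrow> 'a" where
  "minor a b c d = a * d - Q (- 1) * (b * c)"

text \<open>
  The conclusions are oriented so that the simplifier rewrites words in the entries to words whose
  letters are sorted by rows and then by columns.
\<close>

lemma row_pairD:
  assumes "row_pair a b c d"
  shows "c * a = Q 1 * (a * c)" "d * b = Q 1 * (b * d)" "c * b = b * c"
    "d * a = a * d - Q (- 1) * (b * c) + Q 1 * (b * c)"
proof -
  show "c * b = b * c" "c * a = Q 1 * (a * c)" "d * b = Q 1 * (b * d)"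
    using assms by (simp_all add: row_pair_def Q_mult_left)
  then show "d * a = a * d - Q (- 1) * (b * c) + Q 1 * (b * c)"
    using assms by (simp add: row_pair_def algebra_simps)
qed

lemma even_rowD: "even_row a b \<Longrightarrow> b * a = Q 1 * (a * b)"
  by (simp add: even_row_def Q_mult_left)

lemma odd_rowD:
  assumes "odd_row a b"
  shows "b * a = - (Q (- 1) * (a * b))" "a * a = 0" "b * b = 0"
  using assms by (simp_all add: odd_row_def Q_mult_left)

context
  fixes a1 b1 a2 b2 a3 b3
  assumes r: "row_pair a1 b1 a2 b2" "row_pair a1 b1 a3 b3" "row_pair a2 b2 a3 b3"
    and e: "even_row a1 b1" "even_row a2 b2"
begin

private lemmas pairs = row_pairD[OF r(1)] row_pairD[OF r(2)] row_pairD[OF r(3)] e[THEN even_rowD]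

private lemmas straighten = pairs pairs[THEN mult_assoc_rule]
  Q_commute[of a1] Q_commute[of a2] Q_commute[of a3]
  Q_commute[of b1] Q_commute[of b2] Q_commute[of b3]
  Q_left_commute[of a1] Q_left_commute[of a2] Q_left_commute[of a3]
  Q_left_commute[of b1] Q_left_commute[of b2] Q_left_commute[of b3]
  minor_def Q_mult Q_mult_left

text \<open>Every word here contains a single letter of row 3 and \<open>row_pair\<close> carries no
  sign, so the third row may be even or odd. The same holds for the next lemma.\<close>

lemma minor12_minor13:
  "minor a1 b1 a2 b2 * minor a1 b1 a3 b3 =
     Q (- 1) * (minor a1 b1 a3 b3 * minor a1 b1 a2 b2)"
  by (simp add: straighten algebra_simps)

lemma minor12_minor23:
  "minor a1 b1 a2 b2 * minor a2 b2 a3 b3 =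
     Q (- 1) * (minor a2 b2 a3 b3 * minor a1 b1 a2 b2)"
  by (simp add: straighten algebra_simps)

lemma minor23_minor13_even:
  assumes o: "even_row a3 b3"
  shows "minor a2 b2 a3 b3 * minor a1 b1 a3 b3 = Q 1 * (minor a1 b1 a3 b3 * minor a2 b2 a3 b3)"
  by (simp add: straighten even_rowD[OF o] even_rowD[OF o, THEN mult_assoc_rule] algebra_simps)

lemma minor23_minor13_odd:
  assumes o: "odd_row a3 b3"
  shows "minor a2 b2 a3 b3 * minor a1 b1 a3 b3 = - (Q (- 1) * (minor a1 b1 a3 b3 * minor a2 b2 a3 b3))"
  by (simp add: straighten odd_rowD[OF o] odd_rowD[OF o, THEN mult_assoc_rule] algebra_simps)

text \<open>Sorted words with a repeated odd letter vanish. What remains are multiples of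
  \<open>a1 * b1 * a3 * b3\<close>, and their coefficients cancel.\<close>

lemma minor13_square_odd:
  assumes o: "odd_row a3 b3"
  shows "minor a1 b1 a3 b3 * minor a1 b1 a3 b3 = 0"
  by (simp add: straighten odd_rowD[OF o] odd_rowD[OF o, THEN mult_assoc_rule] algebra_simps)

lemma minor23_square_odd:
  assumes o: "odd_row a3 b3"
  shows "minor a2 b2 a3 b3 * minor a2 b2 a3 b3 = 0"
  by (simp add: straighten odd_rowD[OF o] odd_rowD[OF o, THEN mult_assoc_rule] algebra_simps)

context
  fixes a4 b4
  assumes r': "row_pair a1 b1 a4 b4" "row_pair a2 b2 a4 b4" "row_pair a3 b3 a4 b4"
begin

private lemmas pairs4 = row_pairD[OF r'(1)] row_pairD[OF r'(2)] row_pairD[OF r'(3)]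

private lemmas straighten4 = straighten pairs4 pairs4[THEN mult_assoc_rule]
  Q_commute[of a4] Q_commute[of b4] Q_left_commute[of a4] Q_left_commute[of b4]

lemma minor13_minor14:
  "minor a1 b1 a3 b3 * minor a1 b1 a4 b4 =
     Q (- 1) * (minor a1 b1 a4 b4 * minor a1 b1 a3 b3)"
  by (simp add: straighten4 algebra_simps)

lemma minor23_minor24:
  "minor a2 b2 a3 b3 * minor a2 b2 a4 b4 =
     Q (- 1) * (minor a2 b2 a4 b4 * minor a2 b2 a3 b3)"
  by (simp add: straighten4 algebra_simps)

lemma minor23_minor14:
  "minor a2 b2 a3 b3 * minor a1 b1 a4 b4 =
     minor a1 b1 a4 b4 * minor a2 b2 a3 b3"
  by (simp add: straighten4 algebra_simps)

text \<open>Among the four pairings of a minor on row 3 with one on row 4 this is the only one with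
  a correction; it becomes the relation for \<open>t_32 t_41\<close> and, with row 4 replaced by the
  odd row, the one for \<open>t_i2 tau_51\<close>.\<close>

lemma minor13_minor24:
  "minor a1 b1 a3 b3 * minor a2 b2 a4 b4 =
     minor a2 b2 a4 b4 * minor a1 b1 a3 b3
     + (Q (- 1) - Q 1) * (minor a1 b1 a4 b4 * minor a2 b2 a3 b3)"
  by (simp add: straighten4 algebra_simps)

end

end

end

section \<open>Relations and spanning monomials of the big cell\<close>

text \<open>The bounded entries are the exponents of the odd generators, whose squares
  vanish.\<close>

definition cell_index :: "(nat \<times> nat \<times> nat \<times> nat \<times> nat \<times> nat) set" where
  "cell_index = {(a, b, f, c, d, e). f \<le> 1 \<and> e \<le> 1}"

context central_scalars
begin

definition cell_pair :: "'a \<Rightarrow> 'a \<Rightarrow> 'a \<Rightarrow> 'a \<Rightarrow> bool" where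
  "cell_pair x1 x2 y1 y2 \<longleftrightarrow>
     x1 * y1 = Q (- 1) * (y1 * x1) \<and> x2 * y2 = Q (- 1) * (y2 * x2) \<and> x1 * y2 = y2 * x1 \<and>
     x2 * y1 = y1 * x2 + (Q (- 1) - Q 1) * (y2 * x1)"

definition cell_even :: "'a \<Rightarrow> 'a \<Rightarrow> bool" where
  "cell_even x1 x2 \<longleftrightarrow> x1 * x2 = Q 1 * (x2 * x1)"

definition cell_odd :: "'a \<Rightarrow> 'a \<Rightarrow> bool" where
  "cell_odd x1 x2 \<longleftrightarrow> x1 * x2 = - (Q (- 1) * (x2 * x1)) \<and> x1 * x1 = 0 \<and> x2 * x2 = 0"

definition coord1 :: "'a \<Rightarrow> 'a \<Rightarrow> 'a" where
  "coord1 D d = - (Q (- 1) * (D * d))"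

definition coord2 :: "'a \<Rightarrow> 'a \<Rightarrow> 'a" where
  "coord2 D d = D * d"

lemma inverse_commute:
  assumes "E * D = Q (- 1) * (D * E)" "E * d = 1" "d * E = 1"
  shows "d * D = Q 1 * (D * d)"
proof -
  have "d * D = d * (D * E) * d"
    by (simp add: mult.assoc assms)
  also have "D * E = Q 1 * (E * D)"
    by (simp add: assms Q_mult_left)
  also have "d * (Q 1 * (E * D)) * d = Q 1 * ((d * E) * D * d)"
    by (simp add: Q_left_commute mult.assoc)
  finally show ?thesis
    by (simp add: assms)
qed

context
  fixes a1 b1 a2 b2 a3 b3 d
  assumes r: "row_pair a1 b1 a2 b2" "row_pair a1 b1 a3 b3" "row_pair a2 b2 a3 b3"
    and e: "even_row a1 b1" "even_row a2 b2"
    and d: "minor a1 b1 a2 b2 * d = 1" "d * minor a1 b1 a2 b2 = 1"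
begin

private lemmas move3 =
  inverse_commute[OF minor12_minor13[OF r e] d] inverse_commute[OF minor12_minor23[OF r e] d]

text \<open>With \<open>move3\<close> every \<open>d\<close> passes to the right of the minors, so a
  product of two coordinates becomes, up to sign and a power of q, two minors times
  \<open>d * d\<close>. Relations between minors thus turn into relations between
  coordinates.\<close>

lemma cell_even_minors:
  assumes "even_row a3 b3"
  shows "cell_even (coord1 (minor a2 b2 a3 b3) d) (coord2 (minor a1 b1 a3 b3) d)"
  using minor23_minor13_even[OF r e assms]
  by (simp add: cell_even_def coord1_def coord2_def mult.assoc move3 move3[THEN mult_assoc_rule]
    Q_mult_left Q_left_commute[of "minor _ _ _ _"] Q_left_commute[of d]
    minor23_minor13_even[OF r e assms, THEN mult_assoc_rule])

lemma cell_odd_minors: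
  assumes "odd_row a3 b3"
  shows "cell_odd (coord1 (minor a2 b2 a3 b3) d) (coord2 (minor a1 b1 a3 b3) d)"
  by (simp add: cell_odd_def coord1_def coord2_def mult.assoc move3 move3[THEN mult_assoc_rule]
    Q_mult_left Q_left_commute[of "minor _ _ _ _"] Q_left_commute[of d]
    minor23_minor13_odd[OF r e assms, THEN mult_assoc_rule]
    minor13_square_odd[OF r e assms, THEN mult_assoc_rule]
    minor23_square_odd[OF r e assms, THEN mult_assoc_rule])

lemma cell_pair_minors:
  assumes r': "row_pair a1 b1 a4 b4" "row_pair a2 b2 a4 b4" "row_pair a3 b3 a4 b4"
  shows "cell_pair (coord1 (minor a2 b2 a3 b3) d) (coord2 (minor a1 b1 a3 b3) d)
    (coord1 (minor a2 b2 a4 b4) d) (coord2 (minor a1 b1 a4 b4) d)"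
proof -
  note move4 = inverse_commute[OF minor12_minor13[OF r(1) r'(1,2) e] d]
    inverse_commute[OF minor12_minor23[OF r(1) r'(1,2) e] d]
  note swap = minor13_minor14[OF r e r'] minor23_minor24[OF r e r']
    minor23_minor14[OF r e r'] minor13_minor24[OF r e r']
  show ?thesis
    by (simp add: cell_pair_def coord1_def coord2_def mult.assoc move3 move4
      move3[THEN mult_assoc_rule] move4[THEN mult_assoc_rule] swap[THEN mult_assoc_rule]
      Q_mult_left Q_left_commute[of "minor _ _ _ _"] Q_left_commute[of d] algebra_simps)
qed

end

section \<open>Straightening and spans of ordered monomials\<close>

lemma commute_power:
  assumes "y * x = Q k * (x * y)"
  shows "y * x ^ n = Q (k * int n) * (x ^ n * y)"
proof (induction n)
  case (Suc n)
  have "y * x ^ Suc n = Q k * (x * (y * x ^ n))"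
    using assms by (simp flip: mult.assoc)
  then show ?case
    by (simp add: Suc Q_left_commute[of x] Q_mult_left mult.assoc algebra_simps)
qed simp

text \<open>
  The sum of the corrections picked up by \<open>y1\<close> on its way past \<open>x2 ^ n\<close> is geometric with ratio
  \<open>q\<^sup>2\<close>; the factor \<open>q\<^sup>-\<^sup>1 - q\<close> makes it telescope to two terms. At \<open>n = 0\<close> the coefficient vanishes, so
  the truncated \<open>n - 1\<close> is harmless.
\<close>

lemma commute_power_correction:
  assumes "x2 * y1 = y1 * x2 + (Q (- 1) - Q 1) * z" "z * x2 = Q 2 * (x2 * z)"
  shows "y1 * x2 ^ n = x2 ^ n * y1 + (Q (2 * int n - 1) - Q (- 1)) * (x2 ^ (n - 1) * z)"
proof (induction n)
  case (Suc n)
  have y1: "y1 * x2 = x2 * y1 + (Q 1 - Q (- 1)) * z"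
    using assms(1) by (simp add: algebra_simps)
  have z: "z * x2 ^ n = Q (2 * int n) * (x2 ^ n * z)"
    using assms(2) by (rule commute_power)
  have x2: "x2 * ((Q (2 * int n - 1) - Q (- 1)) * (x2 ^ (n - 1) * z)) =
      (Q (2 * int n - 1) - Q (- 1)) * (x2 ^ n * z)"
    by (cases n) (simp_all add: Q_left_commute[of x2] left_diff_distrib right_diff_distrib mult.assoc)
  have "y1 * x2 ^ Suc n = x2 * (y1 * x2 ^ n) + (Q 1 - Q (- 1)) * (z * x2 ^ n)"
    by (simp add: y1 distrib_right mult.assoc flip: mult.assoc[of y1])
  also have "\<dots> = x2 * (x2 ^ n * y1) + (Q (2 * int n - 1) - Q (- 1)) * (x2 ^ n * z) +
      (Q 1 - Q (- 1)) * (Q (2 * int n) * (x2 ^ n * z))"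
    by (simp only: Suc z x2 distrib_left)
  finally show ?case
    by (simp add: Q_mult_left left_diff_distrib mult.assoc add.commute)
qed simp

inductive_set lspan :: "('k \<Rightarrow> 'a) \<Rightarrow> 'k set \<Rightarrow> 'a set" for N I where
  lspan_0: "0 \<in> lspan N I"
| lspan_add_term: "n \<in> I \<Longrightarrow> y \<in> lspan N I \<Longrightarrow> C c * N n + y \<in> lspan N I"

lemma lspan_term: "n \<in> I \<Longrightarrow> C c * N n \<in> lspan N I"
  using lspan_add_term[OF _ lspan_0] by force

lemma lspan_add: "x \<in> lspan N I \<Longrightarrow> y \<in> lspan N I \<Longrightarrow> x + y \<in> lspan N I"
  by (induction rule: lspan.induct) (auto simp: add.assoc intro: lspan_add_term)

lemma lspan_scale: "x \<in> lspan N I \<Longrightarrow> C c * x \<in> lspan N I"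
  by (induction rule: lspan.induct)
    (auto simp: distrib_left lspan_0 mult.assoc[symmetric] C_mult[symmetric] intro: lspan_add_term)

lemma lspan_uminus: "x \<in> lspan N I \<Longrightarrow> - x \<in> lspan N I"
  using lspan_scale[of x N I "- 1"] by (simp add: C_minus C_1)

lemma lspan_Q: "x \<in> lspan N I \<Longrightarrow> Q k * x \<in> lspan N I"
  unfolding Q_def by (rule lspan_scale)

lemma lspan_diff: "x \<in> lspan N I \<Longrightarrow> y \<in> lspan N I \<Longrightarrow> x - y \<in> lspan N I"
  using lspan_add[of x N I "- y"] by (simp add: lspan_uminus)

lemma lspan_eq_lin_comb:
  assumes "x \<in> lspan N I"
  obtains c where "x = lin_comb N c" "Poly_Mapping.keys c \<subseteq> I"
proof -
  from assms have "\<exists>c. x = lin_comb N c \<and> Poly_Mapping.keys c \<subseteq> I"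
  proof induction
    case lspan_0
    then show ?case by (intro exI[of _ 0]) simp
  next
    case (lspan_add_term n y c)
    then obtain c' where "y = lin_comb N c'" "Poly_Mapping.keys c' \<subseteq> I" by blast
    with lspan_add_term show ?case
      using keys_add[of "Poly_Mapping.single n c" c']
      by (intro exI[of _ "Poly_Mapping.single n c + c'"])
        (auto simp: lin_comb_add lin_comb_single split: if_splits)
  qed
  with that show thesis by blast
qed

text \<open>Words grow on the left, so a span that contains 1 and is stable under left
  multiplication by the generators contains every evaluation.\<close>

lemma ev_in_lspan:
  assumes one: "1 \<in> lspan N I"
    and step: "\<And>x n. x \<in> X \<Longrightarrow> n \<in> I \<Longrightarrow> g x * N n \<in> lspan N I"
    and f: "f \<in> carrier (free_alg X)"
  shows "ev g f \<in> lspan N I"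
proof -
  have step': "g x * y \<in> lspan N I" if "y \<in> lspan N I" "x \<in> X" for x y
    using that
  proof induction
    case (lspan_add_term n y c)
    have "g x * (C c * N n) = C c * (g x * N n)"
      by (metis C_commute mult.assoc)
    with lspan_add_term step show ?case
      by (simp add: distrib_left lspan_add lspan_scale)
  qed (simp add: lspan_0)
  have word: "prod_list (map g l) \<in> lspan N I" if "set l \<subseteq> X" for l
    using that by (induction l) (simp_all add: one step')
  have "(\<Sum>w\<in>A. C (Poly_Mapping.lookup f w) * prod_list (map g (letters w))) \<in> lspan N I"
    if "finite A" "A \<subseteq> Poly_Mapping.keys f" for A
    using that f
    by induction (auto simp: lspan_0 free_alg_def intro!: lspan_add lspan_scale word)
  then show ?thesis
    by (simp add: ev_def lin_comb_def)
qed

text \<open>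
  The order of the generators is such that the correction terms of the two-term relations between
  \<open>g\<close> and \<open>h\<close> only involve generators strictly between \<open>g\<close> and \<open>h\<close>.
\<close>

fun cell_mono :: "(cell_gen \<Rightarrow> 'a) \<Rightarrow> nat \<times> nat \<times> nat \<times> nat \<times> nat \<times> nat \<Rightarrow> 'a" where
  "cell_mono g (a, b, f, c, d, e) = g (Tgen 3 2) ^ a * (g (Tgen 4 2) ^ b * (g (Taugen 2) ^ f *
     (g (Tgen 3 1) ^ c * (g (Tgen 4 1) ^ d * g (Taugen 1) ^ e))))"

definition cell_system :: "(cell_gen \<Rightarrow> 'a) \<Rightarrow> bool" where
  "cell_system g \<longleftrightarrow>
     cell_even (g (Tgen 3 1)) (g (Tgen 3 2)) \<and> cell_even (g (Tgen 4 1)) (g (Tgen 4 2)) \<and>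
     cell_odd (g (Taugen 1)) (g (Taugen 2)) \<and>
     cell_pair (g (Tgen 3 1)) (g (Tgen 3 2)) (g (Tgen 4 1)) (g (Tgen 4 2)) \<and>
     cell_pair (g (Tgen 3 1)) (g (Tgen 3 2)) (g (Taugen 1)) (g (Taugen 2)) \<and>
     cell_pair (g (Tgen 4 1)) (g (Tgen 4 2)) (g (Taugen 1)) (g (Taugen 2))"

text \<open>Straightening may raise an odd exponent to 2. Such a monomial is 0 and so still lies in
  the span, which spares a case distinction later.\<close>

lemma cell_mono_in_lspan:
  assumes "cell_system g"
  shows "cell_mono g n \<in> lspan (cell_mono g) cell_index"
proof -
  obtain a b f c d e where n: "n = (a, b, f, c, d, e)"
    by (cases n)
  show ?thesis
  proof (cases "n \<in> cell_index")
    case True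
    then show ?thesis using lspan_term[of n cell_index 1 "cell_mono g"] by (simp add: C_1)
  next
    case False
    have z: "x ^ k = 0" if "x * x = 0" "\<not> k \<le> 1" for x :: 'a and k
    proof -
      obtain l where "k = Suc (Suc l)"
        using \<open>\<not> k \<le> 1\<close> by (metis One_nat_def not_less_eq_eq old.nat.exhaust le0)
      then show ?thesis using that by (simp flip: mult.assoc)
    qed
    have "cell_mono g n = 0"
      using False assms z[of "g (Taugen 1)" e] z[of "g (Taugen 2)" f]
      by (auto simp: n cell_index_def cell_system_def cell_odd_def)
    then show ?thesis by (simp add: lspan_0)
  qed
qed

text \<open>The new letter is moved from the far left to its place. \<open>x2\<close>,
  \<open>y2\<close>, \<open>s2\<close> and \<open>x1\<close> only q-commute with what they pass;
  \<open>y1\<close> leaves a correction at the powers of \<open>x2\<close>, and \<open>s1\<close>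
  one at \<open>x2\<close> and one at \<open>y2\<close>. The letters x, y, s stand for rows 3, 4, 5
  and the digits for columns.\<close>

lemma gen_mult_cell_mono:
  assumes g: "cell_system g" and x: "x \<in> cell_gens"
  shows "g x * cell_mono g n \<in> lspan (cell_mono g) cell_index"
proof -
  obtain a b f c d e where n: "n = (a, b, f, c, d, e)"
    by (cases n)
  define x1 x2 y1 y2 s1 s2 where gen: "x1 = g (Tgen 3 1)" "x2 = g (Tgen 3 2)" "y1 = g (Tgen 4 1)"
     "y2 = g (Tgen 4 2)" "s1 = g (Taugen 1)" "s2 = g (Taugen 2)"
  note gen' = gen[symmetric] gen[symmetric, simplified]
  have pairs: "cell_even x1 x2" "cell_even y1 y2" "cell_odd s1 s2" "cell_pair x1 x2 y1 y2"
    "cell_pair x1 x2 s1 s2" "cell_pair y1 y2 s1 s2"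
    using g by (simp_all add: cell_system_def gen)
  \<comment> \<open>The trivial factor \<open>Q 0\<close> gives commuting pairs the shape that
    \<open>commute_power\<close> expects.\<close>
  have sw: "x1 * x2 = Q 1 * (x2 * x1)" "y1 * y2 = Q 1 * (y2 * y1)" "y1 * x1 = Q 1 * (x1 * y1)"
    "y2 * x2 = Q 1 * (x2 * y2)" "x1 * y2 = Q 0 * (y2 * x1)"
    "s1 * x1 = Q 1 * (x1 * s1)" "s2 * x2 = Q 1 * (x2 * s2)" "x1 * s2 = Q 0 * (s2 * x1)"
    "s1 * y1 = Q 1 * (y1 * s1)" "s2 * y2 = Q 1 * (y2 * s2)" "y1 * s2 = Q 0 * (s2 * y1)"
    using pairs by (simp_all add: cell_even_def cell_pair_def Q_mult_left)
  have cor: "x2 * y1 = y1 * x2 + (Q (- 1) - Q 1) * (y2 * x1)"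
    "x2 * s1 = s1 * x2 + (Q (- 1) - Q 1) * (s2 * x1)" "y2 * s1 = s1 * y2 + (Q (- 1) - Q 1) * (s2 * y1)"
    using pairs by (simp_all add: cell_pair_def)
  note pw = sw[THEN commute_power]
  have C_left: "x * (C u * y) = C u * (x * y)" for x y u
    by (metis C_commute mult.assoc)
  \<comment> \<open>The factor here is minus a power of q, to which \<open>commute_power\<close>
    does not apply; the sign is carried separately by \<open>C\<close>.\<close>
  have s12: "s1 * s2 ^ k = C ((- 1) ^ k) * (Q (- int k) * (s2 ^ k * s1))" for k
  proof (induction k)
    case (Suc k)
    have "s1 * s2 = - (Q (- 1) * (s2 * s1))"
      using pairs by (simp add: cell_odd_def)
    from mult_assoc_rule[OF this] have "s1 * s2 ^ Suc k = - (Q (- 1) * (s2 * (s1 * s2 ^ k)))"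
      by (simp add: mult.assoc)
    then show ?case
      by (simp add: Suc Q_left_commute[of s2] C_left[of s2] C_left[of "Q _"] C_minus Q_mult_left mult.assoc)
  qed (simp add: C_1)
  have y1_x2: "y1 * x2 ^ k = x2 ^ k * y1 + (Q (2 * int k - 1) - Q (- 1)) * (x2 ^ (k - 1) * (y2 * x1))" for k
    by (rule commute_power_correction[OF cor(1)])
       (simp add: mult.assoc sw sw[THEN mult_assoc_rule] Q_mult_left Q_left_commute[of y2])
  have s1_x2: "s1 * x2 ^ k = x2 ^ k * s1 + (Q (2 * int k - 1) - Q (- 1)) * (x2 ^ (k - 1) * (s2 * x1))" for k
    by (rule commute_power_correction[OF cor(2)])
       (simp add: mult.assoc sw sw[THEN mult_assoc_rule] Q_mult_left Q_left_commute[of s2])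
  have s1_y2: "s1 * y2 ^ k = y2 ^ k * s1 + (Q (2 * int k - 1) - Q (- 1)) * (y2 ^ (k - 1) * (s2 * y1))" for k
    by (rule commute_power_correction[OF cor(3)])
       (simp add: mult.assoc sw sw[THEN mult_assoc_rule] Q_mult_left Q_left_commute[of s2])
  let ?N = "cell_mono g" and ?S = "lspan (cell_mono g) cell_index"
  note rules = pw pw[THEN mult_assoc_rule] s12 s12[THEN mult_assoc_rule] mult.assoc Q_mult_left
    Q_left_commute[of x1] Q_left_commute[of x2] Q_left_commute[of y1] Q_left_commute[of y2]
    Q_left_commute[of s1] Q_left_commute[of s2] Q_left_commute[of "_ ^ _"]
    C_left[of x1] C_left[of x2] C_left[of y1] C_left[of y2] C_left[of s1] C_left[of s2]
    C_left[of "_ ^ _"] C_left[of "Q _"]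
  have S: "?N m \<in> ?S" for m
    using g by (rule cell_mono_in_lspan)
  have "x2 * ?N n = ?N (a + 1, b, f, c, d, e)"
    by (simp add: n gen' mult.assoc)
  moreover have "y2 * ?N n = Q a * ?N (a, b + 1, f, c, d, e)"
    by (simp add: n gen' rules)
  moreover have "s2 * ?N n = Q (a + b) * ?N (a, b, f + 1, c, d, e)"
    by (simp add: n gen' rules)
  moreover have "x1 * ?N n = Q a * ?N (a, b, f, c + 1, d, e)"
    by (simp add: n gen' rules)
  moreover have "y1 * ?N n = Q (b + c) * ?N (a, b, f, c, d + 1, e) +
     (Q (2 * int a - 1) - Q (- 1)) * ?N (a - 1, b + 1, f, c + 1, d, e)"
    by (simp add: n gen' rules y1_x2[THEN mult_assoc_rule] distrib_right left_diff_distrib)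
  moreover have "s1 * ?N n = C ((- 1) ^ f) * (Q (c + d - int f) * ?N (a, b, f, c, d, e + 1)) +
     (Q (2 * int a - 1) - Q (- 1)) * (Q b * ?N (a - 1, b, f + 1, c + 1, d, e)) +
     (Q (2 * int b - 1) - Q (- 1)) * (Q c * ?N (a, b - 1, f + 1, c, d + 1, e))"
    by (simp add: n gen' rules s1_x2[THEN mult_assoc_rule] s1_y2[THEN mult_assoc_rule] algebra_simps)
  ultimately show ?thesis
    using x S unfolding cell_gens_def gen
    by (auto simp: left_diff_distrib mult.assoc simp del: cell_mono.simps
        intro!: lspan_Q lspan_scale lspan_add lspan_diff lspan_uminus)
qed

lemma ev_cell_span:
  assumes "cell_system g" "f \<in> carrier (free_alg cell_gens)"
  shows "ev g f \<in> lspan (cell_mono g) cell_index"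
proof (rule ev_in_lspan[OF _ _ assms(2)])
  show "1 \<in> lspan (cell_mono g) cell_index"
    using cell_mono_in_lspan[OF assms(1), of "(0, 0, 0, 0, 0, 0)"] by simp
qed (simp add: gen_mult_cell_mono assms)

end

section \<open>A representation by shift operators\<close>

type_synonym weyl_point = "(int \<times> int \<times> int \<times> int \<times> int) \<times> (bool \<times> bool)"

text \<open>
  The five integer coordinates belong to the even elementary factors, the two boolean coordinates are
  the occupation numbers of the two odd ones.
\<close>

typedef weyl = "{T :: (weyl_point \<Rightarrow> laurent) \<Rightarrow> weyl_point \<Rightarrow> laurent.
    (\<forall>F G. T (\<lambda>p. F p + G p) = (\<lambda>p. T F p + T G p)) \<and> (\<forall>c F. T (\<lambda>p. c * F p) = (\<lambda>p. c * T F p))}"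
  morphisms weyl_apply Abs_weyl
  by (rule exI[of _ id]) simp

setup_lifting type_definition_weyl
lifting_forget poly_mapping.lifting

lemma weyl_eqI: "(\<And>F p. weyl_apply S F p = weyl_apply T F p) \<Longrightarrow> S = T"
  by (metis ext weyl_apply_inject)

instantiation weyl :: "{ring, monoid_mult}"
begin

lift_definition zero_weyl :: weyl is "\<lambda>F p. 0" by simp
lift_definition one_weyl :: weyl is "\<lambda>F. F" by simp
lift_definition plus_weyl :: "weyl \<Rightarrow> weyl \<Rightarrow> weyl" is "\<lambda>S T F p. S F p + T F p"
  by (simp add: algebra_simps fun_eq_iff)
lift_definition minus_weyl :: "weyl \<Rightarrow> weyl \<Rightarrow> weyl" is "\<lambda>S T F p. S F p - T F p"
  by (simp add: algebra_simps fun_eq_iff)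
lift_definition uminus_weyl :: "weyl \<Rightarrow> weyl" is "\<lambda>S F p. - S F p"
  by (simp add: algebra_simps fun_eq_iff)
lift_definition times_weyl :: "weyl \<Rightarrow> weyl \<Rightarrow> weyl" is "\<lambda>S T F. S (T F)"
  by simp

instance
proof
  fix S T U :: weyl
  show "S * (T + U) = S * T + S * U"
    by transfer simp
qed (transfer; simp add: algebra_simps fun_eq_iff)+

end

lift_definition weyl_scalar :: "laurent \<Rightarrow> weyl" is "\<lambda>c F p. c * F p"
  by (simp add: algebra_simps)

interpretation weyl: central_scalars weyl_scalar
proof
  show "weyl_scalar c * T = T * weyl_scalar c" for c T
    by transfer simp
qed (transfer; simp add: algebra_simps)+

text \<open>
  The operator with parameters \<open>k\<close>, \<open>l\<close>, \<open>s\<close>, \<open>(a, b)\<close> is \<open>q\<^sup>k\<close> times a diagonal operator (with the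
  exponents \<open>l\<close>) times a shift by \<open>s\<close> times the creation operators selected by \<open>a\<close> and \<open>b\<close>. The sign is
  the Jordan--Wigner sign: it makes the two creation operators anticommute.
\<close>

fun wmono_fun :: "int \<Rightarrow> int \<times> int \<times> int \<times> int \<times> int \<times> int \<times> int \<Rightarrow>
    int \<times> int \<times> int \<times> int \<times> int \<Rightarrow> bool \<times> bool \<Rightarrow> (weyl_point \<Rightarrow> laurent) \<Rightarrow> weyl_point \<Rightarrow> laurent" where
  "wmono_fun k (l1, l2, l3, l4, l5, l6, l7) (s1, s2, s3, s4, s5) (a, b) F ((n1, n2, n3, n4, n5), (x, y)) =
     (if (a \<longrightarrow> x) \<and> (b \<longrightarrow> y)
      then (if b \<and> x \<and> \<not> a then - 1 else 1) *
        qpow (k + l1 * n1 + l2 * n2 + l3 * n3 + l4 * n4 + l5 * n5 + l6 * of_bool x + l7 * of_bool y) *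
        F ((n1 - s1, n2 - s2, n3 - s3, n4 - s4, n5 - s5), (x \<and> \<not> a, y \<and> \<not> b))
      else 0)"

lift_definition wmono :: "int \<Rightarrow> int \<times> int \<times> int \<times> int \<times> int \<times> int \<times> int \<Rightarrow>
    int \<times> int \<times> int \<times> int \<times> int \<Rightarrow> bool \<times> bool \<Rightarrow> weyl" is wmono_fun
  by (auto simp: fun_eq_iff algebra_simps)

text \<open>The phase arises when the diagonal part of the right factor passes the shift of the left
  one. The sign arises when the second creation operator on the left meets the first one on the
  right; accordingly \<open>(True, True)\<close> stands for the first creation operator times the
  second.\<close>

lemma wmono_mult:
  "wmono k (l1, l2, l3, l4, l5, l6, l7) (s1, s2, s3, s4, s5) (a, b) *
   wmono m (t1, t2, t3, t4, t5, t6, t7) (u1, u2, u3, u4, u5) (c, d) =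
   (if a \<and> c \<or> b \<and> d then 0 else
    (if b \<and> c then uminus else id)
     (wmono (k + m - (t1 * s1 + t2 * s2 + t3 * s3 + t4 * s4 + t5 * s5 + t6 * of_bool a + t7 * of_bool b))
       (l1 + t1, l2 + t2, l3 + t3, l4 + t4, l5 + t5, l6 + t6, l7 + t7)
       (s1 + u1, s2 + u2, s3 + u3, s4 + u4, s5 + u5) (a \<or> c, b \<or> d)))"
  (is "?S * ?T = ?U")
proof (rule weyl_eqI)
  have qpow_left: "qpow h * (qpow i * z) = qpow (h + i) * z" for h i z
    by (simp add: qpow_mult flip: mult.assoc)
  fix F and p :: weyl_point
  obtain n1 n2 n3 n4 n5 x y where p: "p = ((n1, n2, n3, n4, n5), (x, y))"
    by (metis prod.collapse)
  show "weyl_apply (?S * ?T) F p = weyl_apply ?U F p"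
    unfolding p
    by (cases a; cases b; cases c; cases d; cases x; cases y)
      (simp_all add: wmono.rep_eq times_weyl.rep_eq zero_weyl.rep_eq uminus_weyl.rep_eq
        qpow_mult qpow_left algebra_simps)
qed

lemma weyl_Q: "weyl.Q k = wmono k (0, 0, 0, 0, 0, 0, 0) (0, 0, 0, 0, 0) (False, False)"
  unfolding weyl.Q_def by transfer (auto simp: fun_eq_iff)

lemma weyl_one: "1 = wmono 0 (0, 0, 0, 0, 0, 0, 0) (0, 0, 0, 0, 0) (False, False)"
  using weyl_Q[of 0] by simp

text \<open>
  The entries of the product \<open>X\<^sub>4(\<eta>\<^sub>1) X\<^sub>3(u\<^sub>1) X\<^sub>2(v\<^sub>1) X\<^sub>1(w) X\<^sub>4(\<eta>\<^sub>2) X\<^sub>3(u\<^sub>2) X\<^sub>2(v\<^sub>2)\<close>, where \<open>X\<^sub>i(z)\<close> differs from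
  the identity matrix in the rows and columns \<open>i\<close> and \<open>i + 1\<close>, with block
  \<open>((k, 0), (z, k\<^sup>-\<^sup>1))\<close> for \<open>i < 4\<close> and \<open>((k, 0), (z, k))\<close> for \<open>i = 4\<close>, and \<open>k z = q\<^sup>-\<^sup>1 z k\<close>. The
  coordinates are listed in the order \<open>u\<^sub>1, v\<^sub>1, w, u\<^sub>2, v\<^sub>2\<close> and \<open>\<eta>\<^sub>1, \<eta>\<^sub>2\<close>. Two odd factors are needed to
  keep both odd generators of the big cell independent.
\<close>

definition weyl_ent :: "nat \<Rightarrow> nat \<Rightarrow> weyl" where
  "weyl_ent i j =
    (if i = 1 \<and> j = 1 then wmono 0 (0, 0, - 1, 0, 0, 0, 0) (0, 0, 0, 0, 0) (False, False) else
    (if i = 2 \<and> j = 1 then wmono 0 (0, - 1, 0, 0, 0, 0, 0) (0, 0, 1, 0, 0) (False, False) else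
    (if i = 2 \<and> j = 2 then wmono 0 (0, - 1, 1, 0, - 1, 0, 0) (0, 0, 0, 0, 0) (False, False) else
    (if i = 3 \<and> j = 1 then wmono 0 (- 1, 0, 0, 0, 0, 0, 0) (0, 1, 1, 0, 0) (False, False) else
    (if i = 3 \<and> j = 2 then wmono 0 (- 1, 0, 1, 0, - 1, 0, 0) (0, 1, 0, 0, 0) (False, False) +
        wmono 0 (- 1, 1, 0, - 1, 0, 0, 0) (0, 0, 0, 0, 1) (False, False) else
    (if i = 3 \<and> j = 3 then wmono 0 (- 1, 1, 0, - 1, 1, 0, 0) (0, 0, 0, 0, 0) (False, False) else
    (if i = 4 \<and> j = 1 then wmono 0 (0, 0, 0, 0, 0, - 1, 0) (1, 1, 1, 0, 0) (False, False) else
    (if i = 4 \<and> j = 2 then wmono 0 (0, 0, 1, 0, - 1, - 1, 0) (1, 1, 0, 0, 0) (False, False) +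
        wmono 0 (1, 0, 0, 0, 0, - 1, - 1) (0, 0, 0, 1, 1) (False, False) +
        wmono 0 (0, 1, 0, - 1, 0, - 1, 0) (1, 0, 0, 0, 1) (False, False) else
    (if i = 4 \<and> j = 3 then wmono 0 (1, 0, 0, 0, 1, - 1, - 1) (0, 0, 0, 1, 0) (False, False) +
        wmono 0 (0, 1, 0, - 1, 1, - 1, 0) (1, 0, 0, 0, 0) (False, False) else
    (if i = 4 \<and> j = 4 then wmono 0 (1, 0, 0, 1, 0, - 1, - 1) (0, 0, 0, 0, 0) (False, False) else
    (if i = 5 \<and> j = 1 then wmono 0 (0, 0, 0, 0, 0, 0, 0) (1, 1, 1, 0, 0) (True, False) else
    (if i = 5 \<and> j = 2 then wmono 0 (0, 0, 1, 0, - 1, 0, 0) (1, 1, 0, 0, 0) (True, False) +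
        wmono 0 (0, 0, 0, 0, 0, - 1, 0) (0, 0, 0, 1, 1) (False, True) +
        wmono 0 (1, 0, 0, 0, 0, 0, - 1) (0, 0, 0, 1, 1) (True, False) +
        wmono 0 (0, 1, 0, - 1, 0, 0, 0) (1, 0, 0, 0, 1) (True, False) else
    (if i = 5 \<and> j = 3 then wmono 0 (0, 0, 0, 0, 1, - 1, 0) (0, 0, 0, 1, 0) (False, True) +
        wmono 0 (1, 0, 0, 0, 1, 0, - 1) (0, 0, 0, 1, 0) (True, False) +
        wmono 0 (0, 1, 0, - 1, 1, 0, 0) (1, 0, 0, 0, 0) (True, False) else
    (if i = 5 \<and> j = 4 then wmono 0 (0, 0, 0, 1, 0, - 1, 0) (0, 0, 0, 0, 0) (False, True) +
        wmono 0 (1, 0, 0, 1, 0, 0, - 1) (0, 0, 0, 0, 0) (True, False) else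
    (if i = 5 \<and> j = 5 then wmono 0 (0, 0, 0, 0, 0, - 1, - 1) (0, 0, 0, 0, 0) (False, False) else
    0)))))))))))))))"

lemma weyl_ent_simps:
  "weyl_ent 1 1 = wmono 0 (0, 0, - 1, 0, 0, 0, 0) (0, 0, 0, 0, 0) (False, False)"
  "weyl_ent 1 2 = 0"
  "weyl_ent 1 3 = 0"
  "weyl_ent 1 4 = 0"
  "weyl_ent 1 5 = 0"
  "weyl_ent 2 1 = wmono 0 (0, - 1, 0, 0, 0, 0, 0) (0, 0, 1, 0, 0) (False, False)"
  "weyl_ent 2 2 = wmono 0 (0, - 1, 1, 0, - 1, 0, 0) (0, 0, 0, 0, 0) (False, False)"
  "weyl_ent 2 3 = 0"
  "weyl_ent 2 4 = 0"
  "weyl_ent 2 5 = 0"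
  "weyl_ent 3 1 = wmono 0 (- 1, 0, 0, 0, 0, 0, 0) (0, 1, 1, 0, 0) (False, False)"
  "weyl_ent 3 2 = wmono 0 (- 1, 0, 1, 0, - 1, 0, 0) (0, 1, 0, 0, 0) (False, False) +
        wmono 0 (- 1, 1, 0, - 1, 0, 0, 0) (0, 0, 0, 0, 1) (False, False)"
  "weyl_ent 3 3 = wmono 0 (- 1, 1, 0, - 1, 1, 0, 0) (0, 0, 0, 0, 0) (False, False)"
  "weyl_ent 3 4 = 0"
  "weyl_ent 3 5 = 0"
  "weyl_ent 4 1 = wmono 0 (0, 0, 0, 0, 0, - 1, 0) (1, 1, 1, 0, 0) (False, False)"
  "weyl_ent 4 2 = wmono 0 (0, 0, 1, 0, - 1, - 1, 0) (1, 1, 0, 0, 0) (False, False) +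
        wmono 0 (1, 0, 0, 0, 0, - 1, - 1) (0, 0, 0, 1, 1) (False, False) +
        wmono 0 (0, 1, 0, - 1, 0, - 1, 0) (1, 0, 0, 0, 1) (False, False)"
  "weyl_ent 4 3 = wmono 0 (1, 0, 0, 0, 1, - 1, - 1) (0, 0, 0, 1, 0) (False, False) +
        wmono 0 (0, 1, 0, - 1, 1, - 1, 0) (1, 0, 0, 0, 0) (False, False)"
  "weyl_ent 4 4 = wmono 0 (1, 0, 0, 1, 0, - 1, - 1) (0, 0, 0, 0, 0) (False, False)"
  "weyl_ent 4 5 = 0"
  "weyl_ent 5 1 = wmono 0 (0, 0, 0, 0, 0, 0, 0) (1, 1, 1, 0, 0) (True, False)"
  "weyl_ent 5 2 = wmono 0 (0, 0, 1, 0, - 1, 0, 0) (1, 1, 0, 0, 0) (True, False) +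
        wmono 0 (0, 0, 0, 0, 0, - 1, 0) (0, 0, 0, 1, 1) (False, True) +
        wmono 0 (1, 0, 0, 0, 0, 0, - 1) (0, 0, 0, 1, 1) (True, False) +
        wmono 0 (0, 1, 0, - 1, 0, 0, 0) (1, 0, 0, 0, 1) (True, False)"
  "weyl_ent 5 3 = wmono 0 (0, 0, 0, 0, 1, - 1, 0) (0, 0, 0, 1, 0) (False, True) +
        wmono 0 (1, 0, 0, 0, 1, 0, - 1) (0, 0, 0, 1, 0) (True, False) +
        wmono 0 (0, 1, 0, - 1, 1, 0, 0) (1, 0, 0, 0, 0) (True, False)"
  "weyl_ent 5 4 = wmono 0 (0, 0, 0, 1, 0, - 1, 0) (0, 0, 0, 0, 0) (False, True) +
        wmono 0 (1, 0, 0, 1, 0, 0, - 1) (0, 0, 0, 0, 0) (True, False)"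
  "weyl_ent 5 5 = wmono 0 (0, 0, 0, 0, 0, - 1, - 1) (0, 0, 0, 0, 0) (False, False)"
  by (simp_all add: weyl_ent_def)

section \<open>The quantum matrix relations for the operators\<close>

lemma idx_par_simps:
  "idx_par 1 = 0" "idx_par (Suc 0) = 0" "idx_par 2 = 0" "idx_par 3 = 0" "idx_par 4 = 0" "idx_par 5 = 1"
  by (simp_all add: idx_par_def)

lemmas weyl_ent_calc = weyl_ent_simps weyl_ent_simps[simplified One_nat_def] super_sign_def
  idx_par_simps weyl.C_1 weyl.C_minus weyl_Q wmono_mult

text \<open>This and the next three lemmas are checked for all index values:
  \<open>wmono_mult\<close> turns each product into signed \<open>wmono\<close> terms, and the two
  sums are compared. The seven matrices enter only through the entries of their product.\<close>

lemma weyl_ent_rel_row: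
  "\<forall>i\<in>{1, 2, 3, 4, 5}. \<forall>j\<in>{1, 2, 3, 4, 5}. \<forall>l\<in>{1, 2, 3, 4, 5}. j < l \<longrightarrow>
     weyl_ent i j * weyl_ent i l = weyl_scalar (super_sign (Ent i j) (Ent i l)) *
       weyl.Q ((- 1) ^ (idx_par i + 1)) * weyl_ent i l * weyl_ent i j"
  by (simp add: weyl_ent_calc algebra_simps)

lemma weyl_ent_rel_column:
  "\<forall>i\<in>{1, 2, 3, 4, 5}. \<forall>j\<in>{1, 2, 3, 4, 5}. \<forall>k\<in>{1, 2, 3, 4, 5}. i < k \<longrightarrow>
     weyl_ent i j * weyl_ent k j = weyl_scalar (super_sign (Ent i j) (Ent k j)) *
       weyl.Q ((- 1) ^ (idx_par j + 1)) * weyl_ent k j * weyl_ent i j"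
  by (simp add: weyl_ent_calc algebra_simps)

lemma weyl_ent_rel_anti:
  "\<forall>i\<in>{1, 2, 3, 4, 5}. \<forall>j\<in>{1, 2, 3, 4, 5}. \<forall>k\<in>{1, 2, 3, 4, 5}. \<forall>l\<in>{1, 2, 3, 4, 5}.
     i < k \<and> j > l \<or> i > k \<and> j < l \<longrightarrow>
     weyl_ent i j * weyl_ent k l =
       weyl_scalar (super_sign (Ent i j) (Ent k l)) * weyl_ent k l * weyl_ent i j"
  by (simp add: weyl_ent_calc algebra_simps)

lemma weyl_ent_rel_main:
  "\<forall>i\<in>{1, 2, 3, 4, 5}. \<forall>j\<in>{1, 2, 3, 4, 5}. \<forall>k\<in>{1, 2, 3, 4, 5}. \<forall>l\<in>{1, 2, 3, 4, 5}. i < k \<and> j < l \<longrightarrow>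
     weyl_ent i j * weyl_ent k l =
       weyl_scalar (super_sign (Ent i j) (Ent k l)) * weyl_ent k l * weyl_ent i j +
       weyl_scalar (super_sign (Ent i j) (Ent k j)) * (weyl.Q (- 1) - weyl.Q 1) * weyl_ent k j * weyl_ent i l"
  by (simp add: weyl_ent_calc algebra_simps)

text \<open>Every summand of an odd entry has exactly one creation operator. Products with a
  repeated one vanish, and the mixed products cancel in pairs by the Jordan-Wigner sign.\<close>

lemma odd_squares_weyl:
  "\<forall>i\<in>{1, 2, 3, 4, 5}. \<forall>j\<in>{1, 2, 3, 4, 5}. odd (gl_par (Ent i j)) \<longrightarrow> weyl_ent i j * weyl_ent i j = 0"
  by (simp add: weyl_ent_def idx_par_def wmono_mult algebra_simps)

text \<open>One operator inverts both determinants: along the diagonal the factors \<open>k\<close>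
  of the even blocks cancel, while each odd block puts its \<open>k\<close> into both positions
  (4,4) and (5,5).\<close>

fun weyl_gen :: "gl_gen \<Rightarrow> weyl" where
  "weyl_gen (Ent i j) = weyl_ent i j"
| "weyl_gen Det1inv = wmono 0 (0, 0, 0, 0, 0, 1, 1) (0, 0, 0, 0, 0) (False, False)"
| "weyl_gen Det2inv = wmono 0 (0, 0, 0, 0, 0, 1, 1) (0, 0, 0, 0, 0) (False, False)"

text \<open>By lower triangularity a nonzero term has \<open>s i\<close> at most \<open>i\<close>
  for all \<open>i\<close>, and only the identity permutation satisfies this.\<close>

lemma ev_qdet1_weyl:
  "weyl.ev weyl_gen qdet1 = wmono 0 (0, 0, 0, 0, 0, - 1, - 1) (0, 0, 0, 0, 0) (False, False)"
proof -
  let ?t = "\<lambda>s. weyl.ev weyl_gen (scal ((- 1) ^ perm_length s * qpow (- int (perm_length s))) *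
       ent 1 (s 1) * ent 2 (s 2) * ent 3 (s 3) * ent 4 (s 4))"
  have zero: "?t s = 0" if s: "s permutes {1..4}" "s \<noteq> id" for s
  proof -
    obtain i where "i \<in> {1..4}" "\<not> s i \<le> i"
      using permutes_natset_le[OF s(1)] s(2) by blast
    then have "weyl_ent i (s i) = 0"
      by (auto simp: weyl_ent_def)
    moreover from \<open>i \<in> {1..4}\<close> have "i = 1 \<or> i = 2 \<or> i = 3 \<or> i = 4"
      by auto
    ultimately show ?thesis
      by (auto simp: weyl.ev_mult weyl.ev_var)
  qed
  have "weyl.ev weyl_gen qdet1 = (\<Sum>s | s permutes {1..4}. ?t s)"
    by (simp add: qdet1_def weyl.ev_sum)
  also have "\<dots> = ?t id"
    using zero by (subst sum.remove[of _ id]) (auto simp: finite_permutations permutes_id intro!: sum.neutral)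
  also have "perm_length id = 0"
  proof -
    have "{(i, j). i \<in> {1..4} \<and> j \<in> {1..4} \<and> i < j \<and> id i > id j} = ({} :: (nat \<times> nat) set)"
      by auto
    then show ?thesis
      unfolding perm_length_def by (simp only: card.empty)
  qed
  finally show ?thesis
    by (simp add: weyl.ev_mult weyl.ev_var weyl.ev_scal qpow_0 weyl.C_1 weyl_ent_def wmono_mult)
qed

definition weyl_minor12_inv :: weyl where
  "weyl_minor12_inv = wmono 0 (0, 1, 0, 0, 1, 0, 0) (0, 0, 0, 0, 0) (False, False)"

text \<open>The inverse of \<open>D_12\<close> is realised as \<open>D_34\<close> times the inverse
  of \<open>D_1\<close>. The same expression defines \<open>qminor12_inv\<close>, so
  \<open>weyl_cell\<close> is what the lifted coordinates evaluate to.\<close>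

lemma weyl_minor_34:
  "weyl.minor (weyl_ent 3 3) (weyl_ent 3 4) (weyl_ent 4 3) (weyl_ent 4 4) * weyl_gen Det1inv = weyl_minor12_inv"
  by (simp add: weyl.minor_def weyl_ent_def wmono_mult weyl_minor12_inv_def)

fun weyl_cell :: "cell_gen \<Rightarrow> weyl" where
  "weyl_cell (Tgen i j) = (if j = 1
     then weyl.coord1 (weyl.minor (weyl_ent 2 1) (weyl_ent 2 2) (weyl_ent i 1) (weyl_ent i 2)) weyl_minor12_inv
     else weyl.coord2 (weyl.minor (weyl_ent 1 1) (weyl_ent 1 2) (weyl_ent i 1) (weyl_ent i 2)) weyl_minor12_inv)"
| "weyl_cell (Taugen j) = (if j = 1
     then weyl.coord1 (weyl.minor (weyl_ent 2 1) (weyl_ent 2 2) (weyl_ent 5 1) (weyl_ent 5 2)) weyl_minor12_inv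
     else weyl.coord2 (weyl.minor (weyl_ent 1 1) (weyl_ent 1 2) (weyl_ent 5 1) (weyl_ent 5 2)) weyl_minor12_inv)"

lemma weyl_cell_simps:
  "weyl_cell (Tgen 3 1) = - wmono (- 2) (- 1, 1, 0, - 1, 1, 0, 0) (0, 0, 1, 0, 1) (False, False)"
  "weyl_cell (Tgen 3 2) = wmono (- 1) (- 1, 1, 0, 0, 0, 0, 0) (0, 1, 0, 0, 0) (False, False) +
     wmono (- 1) (- 1, 2, - 1, - 1, 1, 0, 0) (0, 0, 0, 0, 1) (False, False)"
  "weyl_cell (Tgen 4 1) = - wmono (- 2) (1, 0, 0, 0, 1, - 1, - 1) (0, 0, 1, 1, 1) (False, False) -
     wmono (- 2) (0, 1, 0, - 1, 1, - 1, 0) (1, 0, 1, 0, 1) (False, False)"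
  "weyl_cell (Tgen 4 2) = wmono (- 1) (0, 1, 0, 0, 0, - 1, 0) (1, 1, 0, 0, 0) (False, False) +
     wmono (- 1) (1, 1, - 1, 0, 1, - 1, - 1) (0, 0, 0, 1, 1) (False, False) +
     wmono (- 1) (0, 2, - 1, - 1, 1, - 1, 0) (1, 0, 0, 0, 1) (False, False)"
  "weyl_cell (Taugen 1) = - wmono (- 2) (0, 0, 0, 0, 1, - 1, 0) (0, 0, 1, 1, 1) (False, True) -
     wmono (- 2) (1, 0, 0, 0, 1, 0, - 1) (0, 0, 1, 1, 1) (True, False) -
     wmono (- 2) (0, 1, 0, - 1, 1, 0, 0) (1, 0, 1, 0, 1) (True, False)"
  "weyl_cell (Taugen 2) = wmono (- 1) (0, 1, 0, 0, 0, 0, 0) (1, 1, 0, 0, 0) (True, False) +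
     wmono (- 1) (0, 1, - 1, 0, 1, - 1, 0) (0, 0, 0, 1, 1) (False, True) +
     wmono (- 1) (1, 1, - 1, 0, 1, 0, - 1) (0, 0, 0, 1, 1) (True, False) +
     wmono (- 1) (0, 2, - 1, - 1, 1, 0, 0) (1, 0, 0, 0, 1) (True, False)"
  by (simp_all add: weyl.coord1_def weyl.coord2_def weyl.minor_def weyl_ent_def weyl_minor12_inv_def weyl_Q
    wmono_mult algebra_simps)

text \<open>The weights are chosen so that the first summand of each line of \<open>weyl_cell_simps\<close> is the
  unique one of maximal height.\<close>

definition height :: "weyl_point \<Rightarrow> int" where
  "height = (\<lambda>((n1, n2, n3, n4, n5), (x, y)). 3 * n2 + n4 + of_bool y)"

definition leading :: "(weyl_point \<Rightarrow> laurent) \<Rightarrow> weyl_point \<Rightarrow> bool" where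
  "leading F p \<longleftrightarrow> F p \<noteq> 0 \<and> (\<forall>p'. p' \<noteq> p \<and> height p' \<ge> height p \<longrightarrow> F p' = 0)"

lemma qpow_nonzero: "qpow k \<noteq> 0"
  by (metis qpow_0 qpow_mult add.right_inverse mult_zero_left zero_neq_one)

lemmas weyl_apply_simps = wmono.rep_eq plus_weyl.rep_eq minus_weyl.rep_eq uminus_weyl.rep_eq

text \<open>\<open>P\<close>, \<open>r\<close> and \<open>c\<close> describe the leading summand of
  an operator: where it is nonzero, which point of \<open>F\<close> it reads, and its coefficient.
  From the height of the new point upwards, the other summands read \<open>F\<close> strictly above
  its leading point and drop out. Points are spelled out in coordinates so that the premises become
  linear arithmetic.\<close>

lemma leading_step:
  assumes F: "leading F ((n1, n2, n3, n4, n5), (x, y))"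
    and G: "\<And>m1 m2 m3 m4 m5 x' y'.
      (\<And>a1 a2 a3 a4 a5 a b. 3 * n2 + n4 + of_bool y < 3 * a2 + a4 + of_bool b \<Longrightarrow>
        F ((a1, a2, a3, a4, a5), (a, b)) = 0) \<Longrightarrow>
      3 * k2 + k4 + of_bool v \<le> 3 * m2 + m4 + of_bool y' \<Longrightarrow>
      G ((m1, m2, m3, m4, m5), (x', y')) = c ((m1, m2, m3, m4, m5), (x', y')) *
      (if P ((m1, m2, m3, m4, m5), (x', y')) then F (r ((m1, m2, m3, m4, m5), (x', y'))) else 0)"
    and r: "\<And>m1 m2 m3 m4 m5 x' y'. P ((m1, m2, m3, m4, m5), (x', y')) \<Longrightarrow>
        height (r ((m1, m2, m3, m4, m5), (x', y'))) =
        height ((m1, m2, m3, m4, m5), (x', y')) + height ((n1, n2, n3, n4, n5), (x, y)) -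
        height ((k1, k2, k3, k4, k5), (u, v))"
    and inj: "\<And>m1 m2 m3 m4 m5 x' y'. P ((m1, m2, m3, m4, m5), (x', y')) \<Longrightarrow>
        r ((m1, m2, m3, m4, m5), (x', y')) = ((n1, n2, n3, n4, n5), (x, y)) \<Longrightarrow>
        ((m1, m2, m3, m4, m5), (x', y')) = ((k1, k2, k3, k4, k5), (u, v))"
    and q: "P ((k1, k2, k3, k4, k5), (u, v))"
      "r ((k1, k2, k3, k4, k5), (u, v)) = ((n1, n2, n3, n4, n5), (x, y))"
      "c ((k1, k2, k3, k4, k5), (u, v)) \<noteq> 0"
  shows "leading G ((k1, k2, k3, k4, k5), (u, v))"
proof -
  define p q where pq: "p = ((n1, n2, n3, n4, n5), (x, y))" "q = ((k1, k2, k3, k4, k5), (u, v))"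
  note pq' = pq[symmetric]
  have Z: "F ((a1, a2, a3, a4, a5), (a, b)) = 0"
    if "3 * n2 + n4 + of_bool y < 3 * a2 + a4 + of_bool b" for a1 a2 a3 a4 a5 a b
  proof -
    have "height p < height ((a1, a2, a3, a4, a5), (a, b))"
      using that by (simp add: height_def pq)
    then show ?thesis
      using F unfolding leading_def pq' by (metis order_less_irrefl order_less_imp_le)
  qed
  have G': "G p' = c p' * (if P p' then F (r p') else 0)" if "height p' \<ge> height q" for p'
  proof -
    obtain m1 m2 m3 m4 m5 x' y' where p': "p' = ((m1, m2, m3, m4, m5), (x', y'))"
      by (metis prod.collapse)
    show ?thesis
      using that unfolding p' pq by (intro G Z) (simp_all add: height_def)
  qed
  have ri: "height (r p') = height p' + height p - height q \<and> (r p' = p \<longrightarrow> p' = q)" if "P p'" for p'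
  proof -
    obtain m1 m2 m3 m4 m5 x' y' where p': "p' = ((m1, m2, m3, m4, m5), (x', y'))"
      by (metis prod.collapse)
    show ?thesis
      using that r[of m1 m2 m3 m4 m5 x' y'] inj[of m1 m2 m3 m4 m5 x' y'] unfolding p' pq' by blast
  qed
  have F': "F p \<noteq> 0" "\<And>p'. p' \<noteq> p \<Longrightarrow> height p' \<ge> height p \<Longrightarrow> F p' = 0"
    using F unfolding leading_def pq' by blast+
  have "F (r p') = 0" if "P p'" "p' \<noteq> q" "height p' \<ge> height q" for p'
    using F'(2)[of "r p'"] that ri[of p'] by auto
  then have "G p' = 0" if "p' \<noteq> q" "height p' \<ge> height q" for p'
    using that by (simp add: G' del: split_paired_All)
  moreover have "G q \<noteq> 0"
    using q F' by (simp add: G' pq')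
  ultimately show ?thesis
    unfolding leading_def pq' by blast
qed

lemma leading_Tgen_31:
  assumes "leading F ((n1, n2, n3, n4, n5), (x, y))"
  shows "leading (weyl_apply (weyl_cell (Tgen 3 1)) F)
    ((n1, n2, n3 + 1, n4, n5 + 1), (x, y))"
  unfolding weyl_cell_simps
  by (rule leading_step[OF assms, where P = "\<lambda>((m1, m2, m3, m4, m5), (x', y')). True"
        and r = "\<lambda>((m1, m2, m3, m4, m5), (x', y')). ((m1, m2, m3 - 1, m4, m5 - 1), (x', y'))"
        and c = "\<lambda>((m1, m2, m3, m4, m5), (x', y')). - qpow (- 2 - m1 + m2 - m4 + m5)"])
    (simp_all add: weyl_apply_simps height_def qpow_nonzero)

lemma leading_Tgen_32:
  assumes "leading F ((n1, n2, n3, n4, n5), (x, y))"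
  shows "leading (weyl_apply (weyl_cell (Tgen 3 2)) F)
    ((n1, n2 + 1, n3, n4, n5), (x, y))"
  unfolding weyl_cell_simps
  by (rule leading_step[OF assms, where P = "\<lambda>((m1, m2, m3, m4, m5), (x', y')). True"
        and r = "\<lambda>((m1, m2, m3, m4, m5), (x', y')). ((m1, m2 - 1, m3, m4, m5), (x', y'))"
        and c = "\<lambda>((m1, m2, m3, m4, m5), (x', y')). qpow (- 1 - m1 + m2)"])
    (simp_all add: weyl_apply_simps height_def qpow_nonzero)

lemma leading_Tgen_41:
  assumes "leading F ((n1, n2, n3, n4, n5), (x, y))"
  shows "leading (weyl_apply (weyl_cell (Tgen 4 1)) F)
    ((n1, n2, n3 + 1, n4 + 1, n5 + 1), (x, y))"
  unfolding weyl_cell_simps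
  by (rule leading_step[OF assms, where P = "\<lambda>((m1, m2, m3, m4, m5), (x', y')). True"
        and r = "\<lambda>((m1, m2, m3, m4, m5), (x', y')). ((m1, m2, m3 - 1, m4 - 1, m5 - 1), (x', y'))"
        and c = "\<lambda>((m1, m2, m3, m4, m5), (x', y')). - qpow (- 2 + m1 + m5 - of_bool x' - of_bool y')"])
    (simp_all add: weyl_apply_simps height_def qpow_nonzero)

lemma leading_Tgen_42:
  assumes "leading F ((n1, n2, n3, n4, n5), (x, y))"
  shows "leading (weyl_apply (weyl_cell (Tgen 4 2)) F)
    ((n1 + 1, n2 + 1, n3, n4, n5), (x, y))"
  unfolding weyl_cell_simps
  by (rule leading_step[OF assms, where P = "\<lambda>((m1, m2, m3, m4, m5), (x', y')). True"
        and r = "\<lambda>((m1, m2, m3, m4, m5), (x', y')). ((m1 - 1, m2 - 1, m3, m4, m5), (x', y'))"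
        and c = "\<lambda>((m1, m2, m3, m4, m5), (x', y')). qpow (- 1 + m2 - of_bool x')"])
    (simp_all add: weyl_apply_simps height_def qpow_nonzero)

text \<open>The leading summand creates the second mode, hence needs it empty. The first mode may be
  occupied, which is the origin of the sign in \<open>c\<close>.\<close>

lemma leading_Taugen_1:
  assumes "leading F ((n1, n2, n3, n4, n5), (x, False))"
  shows "leading (weyl_apply (weyl_cell (Taugen 1)) F)
    ((n1, n2, n3 + 1, n4 + 1, n5 + 1), (x, True))"
  unfolding weyl_cell_simps
  by (rule leading_step[OF assms, where P = "\<lambda>((m1, m2, m3, m4, m5), (x', y')). y'"
        and r = "\<lambda>((m1, m2, m3, m4, m5), (x', y')). ((m1, m2, m3 - 1, m4 - 1, m5 - 1), (x', False))"
        and c = "\<lambda>((m1, m2, m3, m4, m5), (x', y')).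
          - (if x' then - 1 else 1) * qpow (- 2 + m5 - of_bool x')"])
    (simp_all add: weyl_apply_simps height_def qpow_nonzero)

text \<open>The summands have heights 3, 2, 1 and 0. The competitor of height 2 raises both the
  fourth coordinate and the second mode, which is why the second coordinate needs weight 3.\<close>

lemma leading_Taugen_2:
  assumes "leading F ((n1, n2, n3, n4, n5), (False, y))"
  shows "leading (weyl_apply (weyl_cell (Taugen 2)) F)
    ((n1 + 1, n2 + 1, n3, n4, n5), (True, y))"
  unfolding weyl_cell_simps
  by (rule leading_step[OF assms, where P = "\<lambda>((m1, m2, m3, m4, m5), (x', y')). x'"
        and r = "\<lambda>((m1, m2, m3, m4, m5), (x', y')). ((m1 - 1, m2 - 1, m3, m4, m5), (False, y'))"
        and c = "\<lambda>((m1, m2, m3, m4, m5), (x', y')). qpow (- 1 + m2)"])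
    (simp_all add: weyl_apply_simps height_def qpow_nonzero, (intro conjI impI; simp))

section \<open>Presented superalgebras\<close>

lemma (in ring_hom_ring) image_ideal:
  assumes surj: "h ` carrier R = carrier S" and I: "ideal I R"
  shows "ideal (h ` I) S"
proof (rule idealI)
  interpret I: ideal I R by (rule I)
  show "ring S" by (rule S.ring_axioms)
  show "subgroup (h ` I) (add_monoid S)"
    by (rule img_is_add_subgroup) (rule I.a_subgroup)
  fix a x assume a: "a \<in> h ` I" and x: "x \<in> carrier S"
  from a obtain i where i: "a = h i" "i \<in> I" by blast
  from x surj obtain r where r: "x = h r" "r \<in> carrier R" by (metis imageE)
  show "x \<otimes>\<^bsub>S\<^esub> a \<in> h ` I" "a \<otimes>\<^bsub>S\<^esub> x \<in> h ` I"
    using I.I_l_closed[OF i(2) r(2)] I.I_r_closed[OF i(2) r(2)] hom_mult[OF r(2) I.Icarr[OF i(2)]]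
      hom_mult[OF I.Icarr[OF i(2)] r(2)] unfolding i(1) r(1) by (metis imageI)+
qed

text \<open>The image of \<open>I\<close> is an ideal that contains the generators, so
  \<open>h f = h i\<close> for some \<open>i\<close> in \<open>I\<close>, and \<open>f\<close>
  differs from \<open>i\<close> by an element of the kernel. This lets the two successive quotients
  behind \<open>O_P\<close> be controlled by a single ideal of the free algebra.\<close>

lemma (in ring_hom_ring) genideal_image_imp_mem:
  assumes surj: "h ` carrier R = carrier S" and I: "ideal I R"
    and T: "T \<subseteq> I" and kernel: "a_kernel R S h \<subseteq> I"
    and f: "f \<in> carrier R" "h f \<in> genideal S (h ` T)"
  shows "f \<in> I"
proof -
  interpret I: ideal I R by (rule I)
  have "genideal S (h ` T) \<subseteq> h ` I"
    using image_ideal[OF surj I] T by (intro S.genideal_minimal) auto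
  with f obtain i where i: "i \<in> I" "h f = h i" by blast
  note i' = I.Icarr[OF i(1)]
  have "f \<oplus>\<^bsub>R\<^esub> \<ominus>\<^bsub>R\<^esub> i \<in> carrier R" "h (f \<oplus>\<^bsub>R\<^esub> \<ominus>\<^bsub>R\<^esub> i) = \<zero>\<^bsub>S\<^esub>"
    using f(1) i' by (simp_all add: i(2) S.r_neg)
  with kernel have "f \<oplus>\<^bsub>R\<^esub> \<ominus>\<^bsub>R\<^esub> i \<in> I"
    unfolding a_kernel_def' by blast
  then have "(f \<oplus>\<^bsub>R\<^esub> \<ominus>\<^bsub>R\<^esub> i) \<oplus>\<^bsub>R\<^esub> i \<in> I"
    using i(1) by (rule I.a_closed)
  then show ?thesis
    using f(1) i' by (simp add: R.a_assoc R.l_neg)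
qed

section \<open>The free superalgebra as a ring, and kernels of evaluations\<close>

lemma free_alg_simps [simp]:
  "x \<otimes>\<^bsub>free_alg X\<^esub> y = x * y" "x \<oplus>\<^bsub>free_alg X\<^esub> y = x + y"
  "\<one>\<^bsub>free_alg X\<^esub> = 1" "\<zero>\<^bsub>free_alg X\<^esub> = 0"
  by (simp_all add: free_alg_def)

lemma carrier_free_alg_iff:
  "f \<in> carrier (free_alg X) \<longleftrightarrow> (\<forall>w\<in>Poly_Mapping.keys f. set (letters w) \<subseteq> X)"
  by (simp add: free_alg_def)

lemma free_part_iff:
  "f \<in> free_part X par k \<longleftrightarrow> (\<forall>w\<in>Poly_Mapping.keys f.
     set (letters w) \<subseteq> X \<and> sum_list (map par (letters w)) mod 2 = k mod 2)"
  by (auto simp: free_part_def free_alg_def)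

text \<open>Giving every generator parity 0 makes the closure properties of \<open>free_part\<close>
  available for the carrier.\<close>

lemma carrier_free_alg_eq_free_part: "f \<in> carrier (free_alg X) \<longleftrightarrow> f \<in> free_part X (\<lambda>_. 0) 0"
  by (auto simp: free_part_def sum_list_triv)

lemma free_part_0 [simp]: "0 \<in> free_part X par k"
  by (simp add: free_part_def carrier_free_alg_iff)

lemma free_part_add:
  assumes "f \<in> free_part X par k" "g \<in> free_part X par k"
  shows "f + g \<in> free_part X par k"
  using assms Poly_Mapping.keys_add[of f g] unfolding free_part_iff by blast

lemma free_part_uminus:
  assumes "f \<in> free_part X par k"
  shows "- f \<in> free_part X par k"
proof -
  have "Poly_Mapping.keys (- f) = Poly_Mapping.keys f"
    by (auto simp: in_keys_iff)
  then show ?thesis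
    using assms by (simp add: free_part_iff)
qed

lemma free_part_mult:
  assumes "f \<in> free_part X par k" "g \<in> free_part X par l"
  shows "f * g \<in> free_part X par (k + l)"
proof -
  have "set (letters w) \<subseteq> X \<and> sum_list (map par (letters w)) mod 2 = (k + l) mod 2"
    if w: "w \<in> Poly_Mapping.keys (f * g)" for w
  proof -
    obtain u v where uv: "w = u + v" "u \<in> Poly_Mapping.keys f" "v \<in> Poly_Mapping.keys g"
      using subsetD[OF keys_mult w] by auto
    then have "set (letters u) \<subseteq> X" "set (letters v) \<subseteq> X"
      "sum_list (map par (letters u)) mod 2 = k mod 2" "sum_list (map par (letters v)) mod 2 = l mod 2"
      using assms unfolding free_part_iff by blast+
    then show ?thesis
      using mod_add_cong[of "sum_list (map par (letters u))" 2 k "sum_list (map par (letters v))" l]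
      by (simp add: uv(1) plus_free_word_def)
  qed
  then show ?thesis
    by (simp add: free_part_iff)
qed

lemma free_part_scal: "scal c \<in> free_part X par 0"
  by (auto simp: free_part_def carrier_free_alg_iff scal_def zero_free_word_def split: if_splits)

lemma free_part_var: "x \<in> X \<Longrightarrow> var x \<in> free_part X par (par x)"
  by (auto simp: free_part_def carrier_free_alg_iff var_def)

lemma free_part_cong: "f \<in> free_part X par k \<Longrightarrow> k mod 2 = l mod 2 \<Longrightarrow> f \<in> free_part X par l"
  by (simp add: free_part_def)

lemma scal_1: "scal 1 = 1"
  by (simp add: scal_def)

lemma scal_0 [simp]: "scal 0 = 0"
  by (simp add: scal_def)

lemma free_alg_closed:
  "0 \<in> carrier (free_alg X)" "1 \<in> carrier (free_alg X)" "scal c \<in> carrier (free_alg X)"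
  "x \<in> X \<Longrightarrow> var x \<in> carrier (free_alg X)"
  "f \<in> carrier (free_alg X) \<Longrightarrow> - f \<in> carrier (free_alg X)"
  "f \<in> carrier (free_alg X) \<Longrightarrow> g \<in> carrier (free_alg X) \<Longrightarrow> f + g \<in> carrier (free_alg X)"
  "f \<in> carrier (free_alg X) \<Longrightarrow> g \<in> carrier (free_alg X) \<Longrightarrow> f - g \<in> carrier (free_alg X)"
  "f \<in> carrier (free_alg X) \<Longrightarrow> g \<in> carrier (free_alg X) \<Longrightarrow> f * g \<in> carrier (free_alg X)"
proof -
  note [simp] = carrier_free_alg_eq_free_part
  show "0 \<in> carrier (free_alg X)" "scal c \<in> carrier (free_alg X)"
    by (simp_all add: free_part_scal)
  show "1 \<in> carrier (free_alg X)"
    using free_part_scal[of 1] by (simp add: scal_1)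
  show "x \<in> X \<Longrightarrow> var x \<in> carrier (free_alg X)"
    using free_part_var[of x X "\<lambda>_. 0"] by simp
  show "f \<in> carrier (free_alg X) \<Longrightarrow> - f \<in> carrier (free_alg X)"
    by (simp add: free_part_uminus)
  show "f \<in> carrier (free_alg X) \<Longrightarrow> g \<in> carrier (free_alg X) \<Longrightarrow> f + g \<in> carrier (free_alg X)"
    by (simp add: free_part_add)
  show "f \<in> carrier (free_alg X) \<Longrightarrow> g \<in> carrier (free_alg X) \<Longrightarrow> f - g \<in> carrier (free_alg X)"
    using free_part_add[of f X _ _ "- g"] by (simp add: free_part_uminus)
  show "f \<in> carrier (free_alg X) \<Longrightarrow> g \<in> carrier (free_alg X) \<Longrightarrow> f * g \<in> carrier (free_alg X)"
    using free_part_mult[of f X _ 0 g 0] by simp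
qed

lemma ring_free_alg: "ring (free_alg X)"
proof (rule ringI)
  show "abelian_group (free_alg X)"
  proof (rule abelian_groupI)
    show "\<exists>y\<in>carrier (free_alg X). y \<oplus>\<^bsub>free_alg X\<^esub> x = \<zero>\<^bsub>free_alg X\<^esub>" if "x \<in> carrier (free_alg X)" for x
      using that by (intro bexI[of _ "- x"]) (simp_all add: free_alg_closed)
  qed (simp_all add: free_alg_closed algebra_simps)
  show "Group.monoid (free_alg X)"
    by (rule monoidI) (simp_all add: free_alg_closed algebra_simps)
qed (simp_all add: free_alg_closed algebra_simps)

interpretation free_alg: ring "free_alg X" for X
  by (rule ring_free_alg)

lemma free_alg_a_inv: "f \<in> carrier (free_alg X) \<Longrightarrow> \<ominus>\<^bsub>free_alg X\<^esub> f = - f"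
  by (rule free_alg.minus_equality) (simp_all add: free_alg_closed)

lemma scal_hom: "scal (c + d) = scal c + scal d" "scal (c * d) = scal c * scal d"
  by (simp_all add: scal_def single_add mult_single)

lemma scal_commute: "scal c * f = f * scal c"
proof -
  have *: "scal c * Poly_Mapping.single w d = Poly_Mapping.single w d * scal c" for w d
    by (simp add: scal_def mult_single mult.commute)
  then show ?thesis
    by (subst (1 2) poly_mapping_sum_monomials[of f, symmetric])
      (simp only: sum_distrib_left sum_distrib_right *)
qed

interpretation free: central_scalars scal
  by unfold_locales (rule scal_1 scal_hom scal_commute)+

lemma single_Word: "Poly_Mapping.single (Word l) c = scal c * prod_list (map var l)"
proof (induction l arbitrary: c)
  case Nil
  then show ?case by (simp add: scal_def zero_free_word_def)
next
  case (Cons x l)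
  have "Poly_Mapping.single (Word (x # l)) c = var x * Poly_Mapping.single (Word l) c"
    by (simp add: var_def mult_single plus_free_word_def)
  also have "\<dots> = (var x * scal c) * prod_list (map var l)"
    by (simp only: Cons mult.assoc)
  also have "var x * scal c = scal c * var x"
    by (rule scal_commute[symmetric])
  also have "scal c * var x * prod_list (map var l) = scal c * prod_list (map var (x # l))"
    by (simp add: mult.assoc)
  finally show ?case .
qed

lemma free_alg_induct [consumes 1, case_names scal var add mult]:
  assumes f: "f \<in> carrier (free_alg X)"
    and scal: "\<And>c. P (scal c)"
    and var: "\<And>x. x \<in> X \<Longrightarrow> P (var x)"
    and add: "\<And>f g. f \<in> carrier (free_alg X) \<Longrightarrow> g \<in> carrier (free_alg X) \<Longrightarrow> P f \<Longrightarrow> P g \<Longrightarrow> P (f + g)"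
    and mult: "\<And>f g. f \<in> carrier (free_alg X) \<Longrightarrow> g \<in> carrier (free_alg X) \<Longrightarrow> P f \<Longrightarrow> P g \<Longrightarrow> P (f * g)"
  shows "P f"
proof -
  let ?Q = "\<lambda>f. f \<in> carrier (free_alg X) \<and> P f"
  have word: "?Q (prod_list (map var l))" if "set l \<subseteq> X" for l
    using that
  proof (induction l)
    case Nil
    then show ?case using scal[of 1] by (simp add: scal_1 free_alg_closed)
  qed (auto intro: mult var free_alg_closed)
  have "?Q (Poly_Mapping.single w c)" if "set (letters w) \<subseteq> X" for w c
  proof -
    have "Poly_Mapping.single w c = scal c * prod_list (map var (letters w))"
      using single_Word[of "letters w" c] by simp
    then show ?thesis
      using word[OF that] by (auto intro: mult scal free_alg_closed)
  qed
  note single = this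
  have "?Q (\<Sum>w\<in>A. Poly_Mapping.single w (Poly_Mapping.lookup f w))"
    if "finite A" "A \<subseteq> Poly_Mapping.keys f" for A
    using that
  proof (induction A rule: finite_induct)
    case empty
    then show ?case using scal[of 0] by (simp add: free_alg_closed)
  qed (use f single in \<open>auto simp: carrier_free_alg_iff[of f] intro!: add free_alg_closed\<close>)
  from this[of "Poly_Mapping.keys f"] show ?thesis
    by (simp add: poly_mapping_sum_monomials)
qed

context central_scalars
begin

text \<open>The uniqueness half of the universal property. It identifies the coset maps with
  evaluations, so that relations in a quotient become equations in a type.\<close>

lemma hom_eq_ev:
  assumes f: "f \<in> carrier (free_alg X)"
    and hom: "\<And>c. h (scal c) = C c"
      "\<And>f g. f \<in> carrier (free_alg X) \<Longrightarrow> g \<in> carrier (free_alg X) \<Longrightarrow> h (f + g) = h f + h g"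
      "\<And>f g. f \<in> carrier (free_alg X) \<Longrightarrow> g \<in> carrier (free_alg X) \<Longrightarrow> h (f * g) = h f * h g"
  shows "h f = ev (\<lambda>x. h (var x)) f"
  using f by (induction rule: free_alg_induct) (simp_all add: hom ev_scal ev_var ev_add ev_mult)

lemma ev_cong:
  assumes "f \<in> carrier (free_alg X)" "\<And>x. x \<in> X \<Longrightarrow> g x = h x"
  shows "ev g f = ev h f"
  using assms(1) by (induction rule: free_alg_induct) (simp_all add: assms(2) ev_scal ev_var ev_add ev_mult)

lemma ev_free_ev: "f \<in> carrier (free_alg X) \<Longrightarrow> ev g (free.ev u f) = ev (\<lambda>x. ev g (u x)) f"
  by (subst hom_eq_ev[where h = "\<lambda>f. ev g (free.ev u f)"])
    (simp_all add: free.ev_scal free.ev_var free.ev_add free.ev_mult ev_scal ev_add ev_mult)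

lemma ideal_ev_kernel: "ideal {f \<in> carrier (free_alg X). ev g f = 0} (free_alg X)"
proof (rule idealI[OF ring_free_alg])
  show "subgroup {f \<in> carrier (free_alg X). ev g f = 0} (add_monoid (free_alg X))"
    by (rule free_alg.add.subgroupI)
      (auto simp: free_alg_closed ev_add ev_minus free_alg_a_inv simp flip: a_inv_def intro!: exI[of _ 0])
qed (simp_all add: free_alg_closed ev_mult)

lemma ev_pres_ideal:
  assumes odd: "\<And>x. x \<in> X \<Longrightarrow> odd (par x) \<Longrightarrow> g x * g x = 0"
    and R: "\<And>r. r \<in> R \<Longrightarrow> ev g r = 0" "R \<subseteq> carrier (free_alg X)"
    and f: "f \<in> pres_ideal X par R"
  shows "ev g f = 0"
proof -
  have "odd_squares X par \<union> R \<subseteq> {f \<in> carrier (free_alg X). ev g f = 0}"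
    using R by (auto simp: odd_squares_def odd ev_mult ev_var free_alg_closed)
  then have "pres_ideal X par R \<subseteq> {f \<in> carrier (free_alg X). ev g f = 0}"
    unfolding pres_ideal_def by (intro free_alg.genideal_minimal ideal_ev_kernel)
  with f show ?thesis by blast
qed

end

lemma odd_squares_subset: "odd_squares X par \<subseteq> carrier (free_alg X)"
  by (auto simp: odd_squares_def free_alg_closed)

lemma ideal_pres_ideal: "R \<subseteq> carrier (free_alg X) \<Longrightarrow> ideal (pres_ideal X par R) (free_alg X)"
  unfolding pres_ideal_def using odd_squares_subset by (intro free_alg.genideal_ideal) blast

lemma rels_in_pres_ideal:
  "R \<subseteq> carrier (free_alg X) \<Longrightarrow> r \<in> odd_squares X par \<union> R \<Longrightarrow> r \<in> pres_ideal X par R"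
  unfolding pres_ideal_def
  using free_alg.genideal_self[of "odd_squares X par \<union> R" X] odd_squares_subset[of X par] by blast

lemma ideal_coset_eq_zero_iff:
  assumes "ideal I R" "f \<in> carrier R"
  shows "I +>\<^bsub>R\<^esub> f = I \<longleftrightarrow> f \<in> I"
proof -
  interpret ideal I R by fact
  show ?thesis using assms(2) rcos_const_imp_mem a_rcos_const by blast
qed

lemma ring_hom_coset:
  assumes "ideal I R"
  shows "ring_hom_ring R (R Quot I) ((+>\<^bsub>R\<^esub>) I)" "(+>\<^bsub>R\<^esub>) I ` carrier R = carrier (R Quot I)"
    "a_kernel R (R Quot I) ((+>\<^bsub>R\<^esub>) I) = I"
proof -
  interpret ideal I R by fact
  show "ring_hom_ring R (R Quot I) ((+>\<^bsub>R\<^esub>) I)"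
    by (rule rcos_ring_hom_ring)
  show "(+>\<^bsub>R\<^esub>) I ` carrier R = carrier (R Quot I)"
    by (auto simp: FactRing_def A_RCOSETS_def')
  show "a_kernel R (R Quot I) ((+>\<^bsub>R\<^esub>) I) = I"
    using ideal_coset_eq_zero_iff[OF assms] a_subset unfolding a_kernel_def' FactRing_def by auto
qed

section \<open>The parabolic superalgebra\<close>

definition gl_rels :: "gl_gen free_elt set" where
  "gl_rels = matrix_rels \<union> inverse_rels"

definition parabolic_entries :: "gl_gen free_elt set" where
  "parabolic_entries = {ent 1 3, ent 1 4, ent 2 3, ent 2 4, ent 1 5, ent 2 5}"

lemma free_alg_sum_closed:
  "(\<And>i. i \<in> S \<Longrightarrow> f i \<in> carrier (free_alg X)) \<Longrightarrow> (\<Sum>i\<in>S. f i) \<in> carrier (free_alg X)"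
  by (induction S rule: infinite_finite_induct) (simp_all add: free_alg_closed)

lemma Ent_in_gl_gens [simp]: "Ent i j \<in> gl_gens \<longleftrightarrow> i \<in> {1..5} \<and> j \<in> {1..5}"
  by (auto simp: gl_gens_def)

lemma ent_closed: "i \<in> {1..5} \<Longrightarrow> j \<in> {1..5} \<Longrightarrow> ent i j \<in> carrier (free_alg gl_gens)"
  by (rule free_alg_closed) simp

lemma det_inv_closed: "var Det1inv \<in> carrier (free_alg gl_gens)" "var Det2inv \<in> carrier (free_alg gl_gens)"
  by (rule free_alg_closed, simp add: gl_gens_def)+

lemma qdet1_closed: "qdet1 \<in> carrier (free_alg gl_gens)"
proof -
  have "s i \<in> {1..5}" if "s permutes {1..4}" "i \<in> {1..4}" for s and i :: nat
    using permutes_in_image[OF that(1), of i] that(2) by auto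
  then show ?thesis
    unfolding qdet1_def by (intro free_alg_sum_closed free_alg_closed ent_closed) auto
qed

lemma matrix_rels_subset: "matrix_rels \<subseteq> carrier (free_alg gl_gens)"
  unfolding matrix_rels_def by (auto intro!: free_alg_closed ent_closed simp del: atLeastAtMost_iff)

lemma gl_rels_subset: "gl_rels \<subseteq> carrier (free_alg gl_gens)"
  using matrix_rels_subset
  by (auto simp: gl_rels_def inverse_rels_def qdet2_def
      intro!: free_alg_closed qdet1_closed det_inv_closed ent_closed)

lemma ideal_GL: "ideal (pres_ideal gl_gens gl_par gl_rels) (free_alg gl_gens)"
  by (rule ideal_pres_ideal[OF gl_rels_subset])

lemma to_GL_eq: "to_GL = (+>\<^bsub>free_alg gl_gens\<^esub>) (pres_ideal gl_gens gl_par gl_rels)"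
  by (rule ext) (simp add: to_GL_def pres_class_def gl_rels_def)

lemma to_GL_hom:
  "ring_hom_ring (free_alg gl_gens) O_GL to_GL"
  "to_GL ` carrier (free_alg gl_gens) = carrier O_GL"
  "a_kernel (free_alg gl_gens) O_GL to_GL = pres_ideal gl_gens gl_par gl_rels"
  unfolding to_GL_eq O_GL_def pres_alg_def gl_rels_def[symmetric] by (rule ring_hom_coset[OF ideal_GL])+

lemma ring_O_GL: "ring O_GL"
  using to_GL_hom(1) by (rule ring_hom_ring.axioms)

lemma parabolic_entries_subset: "parabolic_entries \<subseteq> carrier (free_alg gl_gens)"
  by (auto simp: parabolic_entries_def intro!: ent_closed)

lemma to_GL_entries_subset: "to_GL ` parabolic_entries \<subseteq> carrier O_GL"
  using to_GL_hom(2) parabolic_entries_subset by blast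

lemma parabolic_ideal_eq: "parabolic_ideal = genideal O_GL (to_GL ` parabolic_entries)"
  by (simp only: parabolic_ideal_def parabolic_entries_def)

lemma ideal_parabolic: "ideal parabolic_ideal O_GL"
  unfolding parabolic_ideal_eq by (rule ring.genideal_ideal[OF ring_O_GL to_GL_entries_subset])

lemma to_P_eq: "to_P = (+>\<^bsub>O_GL\<^esub>) parabolic_ideal \<circ> to_GL"
  by (rule ext) (simp add: to_P_def)

lemma to_P_hom:
  "ring_hom_ring (free_alg gl_gens) O_P to_P"
  "to_P ` carrier (free_alg gl_gens) = carrier O_P"
proof -
  note coset = ring_hom_coset[OF ideal_parabolic, folded O_P_def]
  have "to_P \<in> ring_hom (free_alg gl_gens) O_P"
    unfolding to_P_eq
    by (rule ring_hom_trans[OF ring_hom_ring.homh[OF to_GL_hom(1)] ring_hom_ring.homh[OF coset(1)]])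
  then show "ring_hom_ring (free_alg gl_gens) O_P to_P"
    by (rule ring_hom_ringI2[OF ring_free_alg ring_hom_ring.axioms(2)[OF coset(1)]])
  show "to_P ` carrier (free_alg gl_gens) = carrier O_P"
    unfolding to_P_eq by (simp only: image_comp[symmetric] to_GL_hom(2) coset(2))
qed

interpretation O_P: ring O_P
  by (rule ring_hom_ring.axioms(2)[OF to_P_hom(1)])

interpretation to_P: ring_hom_ring "free_alg gl_gens" O_P to_P
  by (rule to_P_hom(1))

lemma to_P_eq_zero_iff:
  assumes "f \<in> carrier (free_alg gl_gens)"
  shows "to_P f = \<zero>\<^bsub>O_P\<^esub> \<longleftrightarrow> to_GL f \<in> parabolic_ideal"
proof -
  have "to_GL f \<in> carrier O_GL"
    using assms to_GL_hom(2) by blast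
  then show ?thesis
    using ideal_coset_eq_zero_iff[OF ideal_parabolic] by (simp add: to_P_eq O_P_def FactRing_def)
qed

lemma to_P_rels_eq_zero:
  assumes "r \<in> odd_squares gl_gens gl_par \<union> gl_rels \<union> parabolic_entries"
  shows "to_P r = \<zero>\<^bsub>O_P\<^esub>"
proof (cases "r \<in> parabolic_entries")
  case True
  then have "to_GL r \<in> parabolic_ideal"
    unfolding parabolic_ideal_eq using ring.genideal_self[OF ring_O_GL to_GL_entries_subset] by blast
  with True parabolic_entries_subset show ?thesis
    using to_P_eq_zero_iff by blast
next
  case False
  with assms have r: "r \<in> pres_ideal gl_gens gl_par gl_rels"
    using rels_in_pres_ideal[OF gl_rels_subset] by blast
  then have "r \<in> a_kernel (free_alg gl_gens) O_GL to_GL"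
    by (simp only: to_GL_hom(3))
  then have "r \<in> carrier (free_alg gl_gens)" "to_GL r = \<zero>\<^bsub>O_GL\<^esub>"
    by (auto simp: a_kernel_def')
  then show ?thesis
    using to_P_eq_zero_iff additive_subgroup.zero_closed[OF ideal.axioms(1)[OF ideal_parabolic]] by simp
qed

text \<open>Through this lemma the operator representation descends to \<open>O_P\<close>: the
  kernel of the evaluation serves as the ideal in \<open>genideal_image_imp_mem\<close>.\<close>

lemma (in central_scalars) ev_eq_zero_if_to_P_eq_zero:
  assumes g: "\<And>r. r \<in> odd_squares gl_gens gl_par \<union> gl_rels \<union> parabolic_entries \<Longrightarrow> ev g r = 0"
    and f: "f \<in> carrier (free_alg gl_gens)" "to_P f = \<zero>\<^bsub>O_P\<^esub>"
  shows "ev g f = 0"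
proof -
  let ?K = "{f \<in> carrier (free_alg gl_gens). ev g f = 0}"
  have "f \<in> ?K"
  proof (rule ring_hom_ring.genideal_image_imp_mem[OF to_GL_hom(1,2)])
    show "ideal ?K (free_alg gl_gens)"
      by (rule ideal_ev_kernel)
    show "parabolic_entries \<subseteq> ?K"
      using g parabolic_entries_subset by blast
    have "pres_ideal gl_gens gl_par gl_rels \<subseteq> ?K"
      unfolding pres_ideal_def using g odd_squares_subset gl_rels_subset
      by (intro free_alg.genideal_minimal ideal_ev_kernel) blast
    then show "a_kernel (free_alg gl_gens) O_GL to_GL \<subseteq> ?K"
      by (simp only: to_GL_hom(3))
    show "to_GL f \<in> genideal O_GL (to_GL ` parabolic_entries)"
      using f by (simp only: to_P_eq_zero_iff flip: parabolic_ideal_eq)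
  qed (rule f)
  then show ?thesis by simp
qed

lemma idx_cases: "i \<in> {1..5} \<longleftrightarrow> i \<in> {1, 2, 3, 4, 5 :: nat}"
  by auto

lemma weyl_kills:
  assumes "r \<in> odd_squares gl_gens gl_par \<union> gl_rels \<union> parabolic_entries"
  shows "weyl.ev weyl_gen r = 0"
proof -
  have ev: "weyl.ev weyl_gen (f - g) = weyl.ev weyl_gen f - weyl.ev weyl_gen g"
    "weyl.ev weyl_gen (f * g) = weyl.ev weyl_gen f * weyl.ev weyl_gen g"
    "weyl.ev weyl_gen (scal c) = weyl_scalar c"
    "weyl.ev weyl_gen (ent i j) = weyl_ent i j" for f g c i j
    by (simp_all add: weyl.ev_diff weyl.ev_mult weyl.ev_scal weyl.ev_var)
  have odd: "weyl.ev weyl_gen r = 0" if "r \<in> odd_squares gl_gens gl_par"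
  proof -
    obtain x where x: "r = var x * var x" "x \<in> gl_gens" "odd (gl_par x)"
      using \<open>r \<in> odd_squares gl_gens gl_par\<close> by (auto simp: odd_squares_def)
    show ?thesis
    proof (cases x)
      case (Ent i j)
      with x have "i \<in> {1, 2, 3, 4, 5}" "j \<in> {1, 2, 3, 4, 5}" "odd (gl_par (Ent i j))"
        unfolding idx_cases[symmetric] by simp_all
      then have "weyl_ent i j * weyl_ent i j = 0"
        using odd_squares_weyl by blast
      then show ?thesis
        by (simp add: x(1) Ent ev)
    qed (use x in simp_all)
  qed
  have mat: "weyl.ev weyl_gen r = 0" if "r \<in> matrix_rels"
    using that unfolding matrix_rels_def idx_cases
  proof (elim UnE CollectE exE conjE)
    fix i j l assume *: "r = ent i j * ent i l
       - scal (super_sign (Ent i j) (Ent i l) * qpow ((- 1) ^ (idx_par i + 1))) * ent i l * ent i j"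
       "i \<in> {1, 2, 3, 4, 5}" "j \<in> {1, 2, 3, 4, 5}" "l \<in> {1, 2, 3, 4, 5}" "j < l"
    show ?thesis
      unfolding *(1) ev weyl.C_mult weyl.Q_def[symmetric] right_minus_eq
      using weyl_ent_rel_row *(2-) by blast
  next
    fix i j k assume *: "r = ent i j * ent k j
       - scal (super_sign (Ent i j) (Ent k j) * qpow ((- 1) ^ (idx_par j + 1))) * ent k j * ent i j"
       "i \<in> {1, 2, 3, 4, 5}" "j \<in> {1, 2, 3, 4, 5}" "k \<in> {1, 2, 3, 4, 5}" "i < k"
    show ?thesis
      unfolding *(1) ev weyl.C_mult weyl.Q_def[symmetric] right_minus_eq
      using weyl_ent_rel_column *(2-) by blast
  next
    fix i j k l assume *: "r = ent i j * ent k l - scal (super_sign (Ent i j) (Ent k l)) * ent k l * ent i j"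
       "i \<in> {1, 2, 3, 4, 5}" "j \<in> {1, 2, 3, 4, 5}" "k \<in> {1, 2, 3, 4, 5}" "l \<in> {1, 2, 3, 4, 5}"
       "i < k \<and> j > l \<or> i > k \<and> j < l"
    show ?thesis
      unfolding *(1) ev right_minus_eq using weyl_ent_rel_anti *(2-) by blast
  next
    fix i j k l assume *: "r = ent i j * ent k l - scal (super_sign (Ent i j) (Ent k l)) * ent k l * ent i j
       - scal (super_sign (Ent i j) (Ent k j) * (qpow (- 1) - qpow 1)) * ent k j * ent i l"
       "i \<in> {1, 2, 3, 4, 5}" "j \<in> {1, 2, 3, 4, 5}" "k \<in> {1, 2, 3, 4, 5}" "l \<in> {1, 2, 3, 4, 5}"
       "i < k" "j < l"
    have "weyl_ent i j * weyl_ent k l =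
       weyl_scalar (super_sign (Ent i j) (Ent k l)) * weyl_ent k l * weyl_ent i j +
       weyl_scalar (super_sign (Ent i j) (Ent k j)) * (weyl.Q (- 1) - weyl.Q 1) * weyl_ent k j * weyl_ent i l"
      using weyl_ent_rel_main *(2-) by blast
    then show ?thesis
      unfolding *(1) ev weyl.C_mult weyl.C_diff weyl.Q_def[symmetric] by simp
  qed
  have inv: "weyl.ev weyl_gen r = 0" if "r \<in> inverse_rels"
    using that
    by (auto simp: inverse_rels_def qdet2_def weyl.ev_diff weyl.ev_mult weyl.ev_var ev_qdet1_weyl weyl_ent_def
      wmono_mult weyl_one)
  have par: "weyl.ev weyl_gen r = 0" if "r \<in> parabolic_entries"
    using that by (auto simp: parabolic_entries_def weyl.ev_var weyl_ent_def)
  show ?thesis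
    using assms odd mat inv par unfolding gl_rels_def by blast
qed

section \<open>The parabolic algebra as a type\<close>

typedef opar = "carrier O_P"
  by blast

setup_lifting type_definition_opar

instantiation opar :: "{ring, monoid_mult}"
begin

lift_definition zero_opar :: opar is "\<zero>\<^bsub>O_P\<^esub>"
  by (rule O_P.zero_closed)
lift_definition one_opar :: opar is "\<one>\<^bsub>O_P\<^esub>"
  by (rule O_P.one_closed)
lift_definition plus_opar :: "opar \<Rightarrow> opar \<Rightarrow> opar" is "(\<oplus>\<^bsub>O_P\<^esub>)"
  by (rule O_P.add.m_closed)
lift_definition uminus_opar :: "opar \<Rightarrow> opar" is "a_inv O_P"
  by (rule O_P.a_inv_closed)
lift_definition minus_opar :: "opar \<Rightarrow> opar \<Rightarrow> opar" is "a_minus O_P"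
  by (rule O_P.minus_closed)
lift_definition times_opar :: "opar \<Rightarrow> opar \<Rightarrow> opar" is "(\<otimes>\<^bsub>O_P\<^esub>)"
  by (rule O_P.m_closed)

instance
  by standard (transfer; rule O_P.a_assoc O_P.a_comm O_P.l_zero O_P.l_neg O_P.minus_eq
      O_P.m_assoc O_P.l_distr O_P.r_distr O_P.l_one O_P.r_one; assumption)+

end

text \<open>Entries with indices beyond 5 also have type \<open>gl_gen\<close>, so not every free
  element lies in the carrier; the value 0 there makes the map total.\<close>

lift_definition opar_of :: "gl_gen free_elt \<Rightarrow> opar" is
  "\<lambda>f. if f \<in> carrier (free_alg gl_gens) then to_P f else \<zero>\<^bsub>O_P\<^esub>"
  by simp

definition opar_scalar :: "laurent \<Rightarrow> opar" where
  "opar_scalar c = opar_of (scal c)"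

lemma opar_of_hom:
  assumes "f \<in> carrier (free_alg gl_gens)" "g \<in> carrier (free_alg gl_gens)"
  shows "opar_of (f + g) = opar_of f + opar_of g" "opar_of (f * g) = opar_of f * opar_of g"
  using assms to_P.hom_add[OF assms] to_P.hom_mult[OF assms]
  by (transfer; simp add: free_alg_closed)+

lemma opar_of_1: "opar_of 1 = 1"
  using to_P.hom_one by transfer (simp add: free_alg_closed)

lemma opar_of_surj: "\<exists>f\<in>carrier (free_alg gl_gens). x = opar_of f"
  by transfer (use to_P_hom(2) in auto)

lemma opar_of_eq_iff:
  assumes "f \<in> carrier (free_alg gl_gens)" "g \<in> carrier (free_alg gl_gens)"
  shows "opar_of f = opar_of g \<longleftrightarrow> to_P f = to_P g"
  using assms by transfer simp

lemma opar_of_eq_0_iff: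
  assumes "f \<in> carrier (free_alg gl_gens)"
  shows "opar_of f = 0 \<longleftrightarrow> to_P f = \<zero>\<^bsub>O_P\<^esub>"
  using assms by transfer simp

interpretation opar: central_scalars opar_scalar
proof
  fix c x
  obtain f where "f \<in> carrier (free_alg gl_gens)" "x = opar_of f"
    using opar_of_surj by blast
  then show "opar_scalar c * x = x * opar_scalar c"
    by (simp add: opar_scalar_def scal_commute free_alg_closed flip: opar_of_hom)
qed (simp_all add: opar_scalar_def scal_1 scal_hom opar_of_1 opar_of_hom free_alg_closed)

definition opar_gen :: "gl_gen \<Rightarrow> opar" where
  "opar_gen x = opar_of (var x)"

lemma opar_of_eq_ev:
  "f \<in> carrier (free_alg gl_gens) \<Longrightarrow> opar_of f = opar.ev opar_gen f"
  unfolding opar_gen_def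
  by (rule opar.hom_eq_ev[where X = gl_gens]) (simp_all add: opar_scalar_def opar_of_hom)

lemma opar_rels:
  assumes "r \<in> odd_squares gl_gens gl_par \<union> gl_rels \<union> parabolic_entries"
  shows "opar.ev opar_gen r = 0"
proof -
  have "r \<in> carrier (free_alg gl_gens)"
    using assms odd_squares_subset gl_rels_subset parabolic_entries_subset by blast
  then show ?thesis
    using opar_of_eq_0_iff[of r] to_P_rels_eq_zero[OF assms] by (simp add: opar_of_eq_ev)
qed

abbreviation oent :: "nat \<Rightarrow> nat \<Rightarrow> opar" where
  "oent i j \<equiv> opar_gen (Ent i j)"

lemma opar_gl_rels: "r \<in> gl_rels \<Longrightarrow> opar.ev opar_gen r = 0"
  by (simp add: opar_rels)

lemma opar_matrix_rel_row:
  assumes "i \<in> {1..5}" "j \<in> {1..5}" "l \<in> {1..5}" "j < l"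
  shows "oent i j * oent i l = opar_scalar (super_sign (Ent i j) (Ent i l)) *
    (opar.Q ((- 1) ^ (idx_par i + 1)) * (oent i l * oent i j))"
proof -
  have "ent i j * ent i l
       - scal (super_sign (Ent i j) (Ent i l) * qpow ((- 1) ^ (idx_par i + 1))) * ent i l * ent i j
     \<in> gl_rels"
    unfolding gl_rels_def matrix_rels_def using assms by blast
  from opar_gl_rels[OF this] show ?thesis
    by (simp add: opar.ev_diff opar.ev_mult opar.ev_scal opar.ev_var opar.C_mult mult.assoc
        flip: opar.Q_def)
qed

lemma opar_matrix_rel_column:
  assumes "i \<in> {1..5}" "j \<in> {1..5}" "k \<in> {1..5}" "i < k"
  shows "oent i j * oent k j = opar_scalar (super_sign (Ent i j) (Ent k j)) *
    (opar.Q ((- 1) ^ (idx_par j + 1)) * (oent k j * oent i j))"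
proof -
  have "ent i j * ent k j
       - scal (super_sign (Ent i j) (Ent k j) * qpow ((- 1) ^ (idx_par j + 1))) * ent k j * ent i j
     \<in> gl_rels"
    unfolding gl_rels_def matrix_rels_def using assms by blast
  from opar_gl_rels[OF this] show ?thesis
    by (simp add: opar.ev_diff opar.ev_mult opar.ev_scal opar.ev_var opar.C_mult mult.assoc
        flip: opar.Q_def)
qed

lemma opar_matrix_rel_anti:
  assumes "i \<in> {1..5}" "j \<in> {1..5}" "k \<in> {1..5}" "l \<in> {1..5}" "i < k" "j > l"
  shows "oent i j * oent k l = opar_scalar (super_sign (Ent i j) (Ent k l)) * (oent k l * oent i j)"
proof -
  have "ent i j * ent k l - scal (super_sign (Ent i j) (Ent k l)) * ent k l * ent i j \<in> gl_rels"
    unfolding gl_rels_def matrix_rels_def using assms by blast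
  from opar_gl_rels[OF this] show ?thesis
    by (simp add: opar.ev_diff opar.ev_mult opar.ev_scal opar.ev_var mult.assoc)
qed

lemma opar_matrix_rel_main:
  assumes "i \<in> {1..5}" "j \<in> {1..5}" "k \<in> {1..5}" "l \<in> {1..5}" "i < k" "j < l"
  shows "oent i j * oent k l - opar_scalar (super_sign (Ent i j) (Ent k l)) * (oent k l * oent i j) =
    opar_scalar (super_sign (Ent i j) (Ent k j)) * ((opar.Q (- 1) - opar.Q 1) * (oent k j * oent i l))"
proof -
  have "ent i j * ent k l - scal (super_sign (Ent i j) (Ent k l)) * ent k l * ent i j
       - scal (super_sign (Ent i j) (Ent k j) * (qpow (- 1) - qpow 1)) * ent k j * ent i l \<in> gl_rels"
    unfolding gl_rels_def matrix_rels_def using assms by blast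
  from opar_gl_rels[OF this] show ?thesis
    by (simp add: opar.ev_diff opar.ev_mult opar.ev_scal opar.ev_var opar.C_mult opar.C_diff mult.assoc
        flip: opar.Q_def)
qed

lemma opar_entry_zero:
  assumes "(i, j) \<in> {(1, 3), (1, 4), (2, 3), (2, 4)}"
  shows "oent i j = 0"
proof -
  have "ent i j \<in> parabolic_entries"
    using assms unfolding parabolic_entries_def by blast
  then show ?thesis
    using opar_rels[of "ent i j"] by (simp add: opar.ev_var)
qed

text \<open>A row that precedes another one is even, as are columns 1 and 2, so all super signs are
  1.\<close>

lemma opar_row_pair:
  assumes "1 \<le> i" "i < k" "k \<le> 5"
  shows "opar.row_pair (oent i 1) (oent i 2) (oent k 1) (oent k 2)"
proof -
  have "idx_par i = 0" "idx_par 1 = 0" "idx_par 2 = 0"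
    using assms by (simp_all add: idx_par_def)
  then show ?thesis
    unfolding opar.row_pair_def
    using assms opar_matrix_rel_column[of i 1 k] opar_matrix_rel_column[of i 2 k]
      opar_matrix_rel_anti[of i 2 k 1] opar_matrix_rel_main[of i 1 k 2]
    by (simp add: super_sign_def opar.C_1)
qed

lemma opar_even_row:
  assumes "1 \<le> i" "i \<le> 4"
  shows "opar.even_row (oent i 1) (oent i 2)"
proof -
  have "idx_par i = 0" "idx_par 1 = 0" "idx_par 2 = 0"
    using assms by (simp_all add: idx_par_def)
  then show ?thesis
    unfolding opar.even_row_def using assms opar_matrix_rel_row[of i 1 2]
    by (simp add: super_sign_def opar.C_1)
qed

lemma opar_odd_row: "opar.odd_row (oent 5 1) (oent 5 2)"
proof -
  have "oent 5 j * oent 5 j = 0" if "j \<in> {1, 2}" for j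
  proof -
    have "ent 5 j * ent 5 j \<in> odd_squares gl_gens gl_par"
      using that by (auto simp: odd_squares_def idx_par_def)
    then show ?thesis
      using opar_rels[of "ent 5 j * ent 5 j"] by (simp add: opar.ev_mult opar.ev_var)
  qed
  moreover have "idx_par 5 = 1" "idx_par 1 = 0" "idx_par 2 = 0"
    by (simp_all add: idx_par_def)
  ultimately show ?thesis
    unfolding opar.odd_row_def using opar_matrix_rel_row[of 5 1 2]
    by (simp add: super_sign_def opar.C_1 opar.C_minus)
qed

text \<open>The correction term of the matrix relation contains \<open>oent i l\<close>, an entry of
  the vanishing upper right block.\<close>

lemma opar_blocks_commute:
  assumes "i \<in> {1, 2}" "j \<in> {1, 2}" "k \<in> {3, 4}" "l \<in> {3, 4}"
  shows "oent k l * oent i j = oent i j * oent k l"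
proof -
  have "idx_par i = 0" "idx_par j = 0" "idx_par k = 0" "idx_par l = 0"
    using assms by (auto simp: idx_par_def)
  moreover have "oent i l = 0"
    using assms by (intro opar_entry_zero) auto
  moreover have "i \<in> {1..5}" "j \<in> {1..5}" "k \<in> {1..5}" "l \<in> {1..5}" "i < k" "j < l"
    using assms by auto
  ultimately show ?thesis
    using opar_matrix_rel_main[of i j k l] by (simp add: super_sign_def opar.C_1)
qed

section \<open>The first quantum determinant in block form\<close>

definition perm4 :: "nat \<Rightarrow> nat \<Rightarrow> nat \<Rightarrow> nat \<Rightarrow> nat \<Rightarrow> nat" where
  "perm4 a b c d = (\<lambda>x. if x = 1 then a else if x = 2 then b
     else if x = 3 then c else if x = 4 then d else x)"

lemma perm4_simps [simp]:
  "perm4 a b c d 1 = a" "perm4 a b c d (Suc 0) = a" "perm4 a b c d 2 = b" "perm4 a b c d 3 = c" "perm4 a b c d 4 = d"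
  by (simp_all add: perm4_def)

lemma perm4_eq_iff [simp]: "perm4 a b c d = perm4 a' b' c' d' \<longleftrightarrow> a = a' \<and> b = b' \<and> c = c' \<and> d = d'"
proof
  assume h: "perm4 a b c d = perm4 a' b' c' d'"
  show "a = a' \<and> b = b' \<and> c = c' \<and> d = d'"
    using fun_cong[OF h, of 1] fun_cong[OF h, of 2] fun_cong[OF h, of 3] fun_cong[OF h, of 4] by simp
qed simp

lemma interval_1_4: "{1..4} = {1, 2, 3, 4 :: nat}"
  by auto

lemma perm4_permutes:
  assumes "{a, b, c, d} = {1..4}"
  shows "perm4 a b c d permutes {1..4}"
proof (rule inj_imp_permutes)
  have "card {a, b, c, d} = 4"
    using assms by simp
  then have "distinct [a, b, c, d]"
    using card_distinct[of "[a, b, c, d]"] by simp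
  then show "inj_on (perm4 a b c d) {1..4}"
    unfolding interval_1_4 by auto
  show "perm4 a b c d x \<in> {1..4}" if "x \<in> {1..4}" for x
    using that unfolding assms[symmetric] by (auto simp: perm4_def)
qed (auto simp: perm4_def)

lemma block_permutations:
  assumes s: "s permutes {1..4}" "s 1 \<in> {1, 2}" "s 2 \<in> {1, 2}"
  shows "s \<in> {perm4 1 2 3 4, perm4 2 1 3 4, perm4 1 2 4 3, perm4 2 1 4 3}"
proof -
  obtain a b c d where eq: "s = perm4 a b c d"
  proof
    show "s = perm4 (s 1) (s 2) (s 3) (s 4)"
      using permutes_not_in[OF s(1)] by (auto simp: perm4_def fun_eq_iff)
  qed
  have "c \<in> {1, 2, 3, 4}" "d \<in> {1, 2, 3, 4}"
    using permutes_in_image[OF s(1), of 3] permutes_in_image[OF s(1), of 4] by (auto simp: eq)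
  moreover have "a \<in> {1, 2}" "b \<in> {1, 2}"
    using s(2,3) by (simp_all add: eq)
  moreover have "a \<noteq> b" "a \<noteq> c" "a \<noteq> d" "b \<noteq> c" "b \<noteq> d" "c \<noteq> d"
    using inj_eq[OF permutes_inj[OF s(1)], of 1 2] inj_eq[OF permutes_inj[OF s(1)], of 1 3]
      inj_eq[OF permutes_inj[OF s(1)], of 1 4] inj_eq[OF permutes_inj[OF s(1)], of 2 3]
      inj_eq[OF permutes_inj[OF s(1)], of 2 4] inj_eq[OF permutes_inj[OF s(1)], of 3 4]
    by (simp_all add: eq)
  ultimately show ?thesis
    unfolding eq by auto
qed

lemma perm_length_blocks:
  "perm_length (perm4 1 2 3 4) = 0" "perm_length (perm4 2 1 3 4) = 1"
  "perm_length (perm4 1 2 4 3) = 1" "perm_length (perm4 2 1 4 3) = 2"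
proof -
  have "{(i, j). i \<in> {1..4} \<and> j \<in> {1..4} \<and> i < j \<and> perm4 1 2 3 4 i > perm4 1 2 3 4 j} = {}"
    "{(i, j). i \<in> {1..4} \<and> j \<in> {1..4} \<and> i < j \<and> perm4 2 1 3 4 i > perm4 2 1 3 4 j} = {(1, 2)}"
    "{(i, j). i \<in> {1..4} \<and> j \<in> {1..4} \<and> i < j \<and> perm4 1 2 4 3 i > perm4 1 2 4 3 j} = {(3, 4)}"
    "{(i, j). i \<in> {1..4} \<and> j \<in> {1..4} \<and> i < j \<and> perm4 2 1 4 3 i > perm4 2 1 4 3 j} = {(1, 2), (3, 4)}"
    unfolding interval_1_4 by auto
  then show "perm_length (perm4 1 2 3 4) = 0" "perm_length (perm4 2 1 3 4) = 1"
    "perm_length (perm4 1 2 4 3) = 1" "perm_length (perm4 2 1 4 3) = 2"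
    by (simp_all only: perm_length_def) simp_all
qed

abbreviation ominor12 :: opar where
  "ominor12 \<equiv> opar.minor (oent 1 1) (oent 1 2) (oent 2 1) (oent 2 2)"

abbreviation ominor34 :: opar where
  "ominor34 \<equiv> opar.minor (oent 3 3) (oent 3 4) (oent 4 3) (oent 4 4)"

text \<open>A permutation that moves 1 or 2 into \<open>{3, 4}\<close> contributes an entry of the
  zero block. For the four others the length is additive over the two blocks, so their terms are
  those of the expanded product of minors.\<close>

lemma opar_qdet1: "opar.ev opar_gen qdet1 = ominor12 * ominor34"
proof -
  let ?t = "\<lambda>s. opar_scalar ((- 1) ^ perm_length s * qpow (- int (perm_length s))) *
       oent 1 (s 1) * oent 2 (s 2) * oent 3 (s 3) * oent 4 (s 4)"
  let ?S = "{perm4 1 2 3 4, perm4 2 1 3 4, perm4 1 2 4 3, perm4 2 1 4 3}"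
  have zero: "?t s = 0" if s: "s permutes {1..4}" "s \<notin> ?S" for s
  proof -
    have "s 1 \<in> {1, 2, 3, 4}" "s 2 \<in> {1, 2, 3, 4}"
      using permutes_in_image[OF s(1), of 1] permutes_in_image[OF s(1), of 2] by auto
    then have "s 1 \<in> {3, 4} \<or> s 2 \<in> {3, 4}"
      using block_permutations[of s] s by blast
    then have "oent 1 (s 1) = 0 \<or> oent 2 (s 2) = 0"
      using opar_entry_zero[of 1 "s 1"] opar_entry_zero[of 2 "s 2"] by blast
    then show ?thesis by auto
  qed
  have S: "?S \<subseteq> {s. s permutes {1..4}}"
    using perm4_permutes[of 1 2 3 4] perm4_permutes[of 2 1 3 4] perm4_permutes[of 1 2 4 3]
      perm4_permutes[of 2 1 4 3] unfolding interval_1_4 by blast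
  have "opar.ev opar_gen qdet1 = (\<Sum>s | s permutes {1..4}. ?t s)"
    by (simp add: qdet1_def opar.ev_sum opar.ev_mult opar.ev_scal opar.ev_var)
  also have "\<dots> = (\<Sum>s\<in>?S. ?t s)"
    by (rule sum.mono_neutral_right) (use S zero in \<open>auto simp: finite_permutations\<close>)
  also have "\<dots> = ominor12 * ominor34"
    by (simp add: perm_length_blocks opar.minor_def opar.C_mult opar.C_1 opar.C_minus qpow_0
      algebra_simps opar.Q_mult_left opar.Q_left_commute[of "oent _ _"] opar.Q_commute[of "oent _ _"]
       flip: opar.Q_def del: One_nat_def)
  finally show ?thesis .
qed

lemma (in central_scalars) minor_commute:
  assumes "z * a = a * z" "z * b = b * z" "z * c = c * z" "z * d = d * z"
  shows "z * minor a b c d = minor a b c d * z"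
proof -
  have product: "z * (x * y) = x * y * z" if "z * x = x * z" "z * y = y * z" for x y
    by (simp add: mult_assoc_rule[OF that(1)] mult.assoc that(2))
  show ?thesis
    using product[of a d] product[of b c] assms
    by (simp add: minor_def right_diff_distrib left_diff_distrib Q_left_commute[of z] mult.assoc)
qed

lemma ominor12_ominor34_commute: "ominor34 * ominor12 = ominor12 * ominor34"
proof -
  have "ominor12 * oent k l = oent k l * ominor12" if "k \<in> {3, 4}" "l \<in> {3, 4}" for k l
    by (rule opar.minor_commute[symmetric]; rule opar_blocks_commute) (use that in auto)
  then show ?thesis
    by (rule opar.minor_commute[symmetric]; simp)
qed

definition ominor12_inv :: opar where
  "ominor12_inv = ominor34 * opar_gen Det1inv"

lemma ominor12_inverse: "ominor12 * ominor12_inv = 1" "ominor12_inv * ominor12 = 1"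
proof -
  let ?u = "opar_gen Det1inv"
  have "opar.ev opar_gen (qdet1 * var Det1inv - 1) = 0" "opar.ev opar_gen (var Det1inv * qdet1 - 1) = 0"
    by (rule opar_rels, simp add: gl_rels_def inverse_rels_def)+
  then have u: "ominor12 * ominor34 * ?u = 1" "?u * (ominor12 * ominor34) = 1"
    by (simp_all add: opar.ev_diff opar.ev_mult opar.ev_var opar_qdet1)
  show 1: "ominor12 * ominor12_inv = 1"
    using u(1) unfolding ominor12_inv_def mult.assoc .
  have 2: "?u * ominor34 * ominor12 = 1"
    unfolding mult.assoc ominor12_ominor34_commute by (rule u(2))
  \<comment> \<open>A left inverse and a right inverse of the same element coincide.\<close>
  have "?u * ominor34 = ?u * ominor34 * (ominor12 * ominor12_inv)"
    unfolding 1 by simp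
  also have "\<dots> = ?u * ominor34 * ominor12 * ominor12_inv"
    by (simp only: mult.assoc)
  finally have "?u * ominor34 = ominor12_inv"
    unfolding 2 by simp
  with 2 show "ominor12_inv * ominor12 = 1" by simp
qed

text \<open>An explicit preimage of the inverse of \<open>D_12\<close>. With it the coordinates lift
  to the free algebra, where they can be evaluated in any representation and their parity can be
  read off.\<close>

definition qminor12_inv :: "gl_gen free_elt" where
  "qminor12_inv = (ent 3 3 * ent 4 4 - scal (qpow (- 1)) * (ent 3 4 * ent 4 3)) * var Det1inv"

definition coord_lift :: "nat \<Rightarrow> nat \<Rightarrow> gl_gen free_elt" where
  "coord_lift i j = (if j = 1 then - scal (qpow (- 1)) * qminor 2 i else qminor 1 i) * qminor12_inv"

fun cell_lift :: "cell_gen \<Rightarrow> gl_gen free_elt" where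
  "cell_lift (Tgen i j) = coord_lift i j"
| "cell_lift (Taugen j) = coord_lift 5 j"

definition opar_cell :: "cell_gen \<Rightarrow> opar" where
  "opar_cell x = opar.ev opar_gen (cell_lift x)"

lemma (in central_scalars) ev_qminor:
  "ev g (qminor i j) = minor (g (Ent i 1)) (g (Ent i 2)) (g (Ent j 1)) (g (Ent j 2))"
  by (simp add: qminor_def minor_def ev_diff ev_mult ev_var ev_scal Q_def mult.assoc)

lemma (in central_scalars) ev_qminor12_inv:
  "ev g qminor12_inv = minor (g (Ent 3 3)) (g (Ent 3 4)) (g (Ent 4 3)) (g (Ent 4 4)) * g Det1inv"
  by (simp add: qminor12_inv_def minor_def ev_diff ev_mult ev_var ev_scal Q_def mult.assoc)

lemma (in central_scalars) ev_coord_lift: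
  "ev g (coord_lift i j) =
    (if j = 1 then coord1 (minor (g (Ent 2 1)) (g (Ent 2 2)) (g (Ent i 1)) (g (Ent i 2))) (ev g qminor12_inv)
     else coord2 (minor (g (Ent 1 1)) (g (Ent 1 2)) (g (Ent i 1)) (g (Ent i 2))) (ev g qminor12_inv))"
  by (simp add: coord_lift_def ev_minus ev_mult ev_scal ev_qminor coord1_def coord2_def mult.assoc flip: Q_def)

lemma opar_cell_Tgen:
  "opar_cell (Tgen i 1) = opar.coord1 (opar.minor (oent 2 1) (oent 2 2) (oent i 1) (oent i 2)) ominor12_inv"
  "opar_cell (Tgen i 2) = opar.coord2 (opar.minor (oent 1 1) (oent 1 2) (oent i 1) (oent i 2)) ominor12_inv"
  unfolding opar_cell_def cell_lift.simps opar.ev_coord_lift opar.ev_qminor12_inv ominor12_inv_def by simp_all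

text \<open>Although \<open>Tgen 5 j\<close> lies outside \<open>cell_gens\<close>,
  \<open>opar_cell\<close> is defined there; this lets the odd row share the lemmas on pairs of
  rows.\<close>

lemma opar_cell_Taugen: "opar_cell (Taugen j) = opar_cell (Tgen 5 j)"
  by (simp add: opar_cell_def)

lemma opar_cell_system: "opar.cell_system opar_cell"
proof -
  have r: "opar.row_pair (oent 1 1) (oent 1 2) (oent 2 1) (oent 2 2)"
    "opar.row_pair (oent 1 1) (oent 1 2) (oent k 1) (oent k 2)"
    "opar.row_pair (oent 2 1) (oent 2 2) (oent k 1) (oent k 2)" if "k \<in> {3, 4, 5}" for k
    by (rule opar_row_pair; use that in auto)+
  have e: "opar.even_row (oent 1 1) (oent 1 2)" "opar.even_row (oent 2 1) (oent 2 2)"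
    using opar_even_row[of 1] opar_even_row[of 2] by simp_all
  have even: "opar.cell_even (opar_cell (Tgen k 1)) (opar_cell (Tgen k 2))" if "k \<in> {3, 4}" for k
    unfolding opar_cell_Tgen
    by (rule opar.cell_even_minors[OF r(1)[of k] r(2,3)[of k] e ominor12_inverse opar_even_row])
      (use that in auto)
  have odd: "opar.cell_odd (opar_cell (Tgen 5 1)) (opar_cell (Tgen 5 2))"
    unfolding opar_cell_Tgen
    by (rule opar.cell_odd_minors[OF r(1)[of 5] r(2,3)[of 5] e ominor12_inverse opar_odd_row]) auto
  have pair: "opar.cell_pair (opar_cell (Tgen k 1)) (opar_cell (Tgen k 2))
      (opar_cell (Tgen l 1)) (opar_cell (Tgen l 2))"
    if "k \<in> {3, 4}" "l \<in> {4, 5}" "k < l" for k l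
    unfolding opar_cell_Tgen
    by (rule opar.cell_pair_minors[OF r(1)[of k] r(2,3)[of k] e ominor12_inverse r(2,3)[of l] opar_row_pair])
      (use that in auto)
  show ?thesis
    using even[of 3] even[of 4] odd pair[of 3 4] pair[of 3 5] pair[of 4 5]
    by (simp add: opar.cell_system_def opar_cell_Taugen)
qed

section \<open>The presented big cell\<close>

lemma cell_rels_eq:
  "cell_rels = {tv 3 1 * tv 3 2 - scal (qpow 1) * tv 3 2 * tv 3 1,
     tv 4 1 * tv 4 2 - scal (qpow 1) * tv 4 2 * tv 4 1,
     tv 3 1 * tv 4 1 - scal (qpow (- 1)) * tv 4 1 * tv 3 1,
     tv 3 2 * tv 4 2 - scal (qpow (- 1)) * tv 4 2 * tv 3 2,
     tv 3 1 * tv 4 2 - tv 4 2 * tv 3 1,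
     tv 3 2 * tv 4 1 - (tv 4 1 * tv 3 2 + scal (qpow (- 1) - qpow 1) * tv 4 2 * tv 3 1),
     tauv 1 * tauv 2 + scal (qpow (- 1)) * tauv 2 * tauv 1,
     tv 3 1 * tauv 1 - scal (qpow (- 1)) * tauv 1 * tv 3 1,
     tv 3 2 * tauv 2 - scal (qpow (- 1)) * tauv 2 * tv 3 2,
     tv 4 1 * tauv 1 - scal (qpow (- 1)) * tauv 1 * tv 4 1,
     tv 4 2 * tauv 2 - scal (qpow (- 1)) * tauv 2 * tv 4 2,
     tv 3 1 * tauv 2 - tauv 2 * tv 3 1, tv 4 1 * tauv 2 - tauv 2 * tv 4 1,
     tv 3 2 * tauv 1 - (tauv 1 * tv 3 2 + scal (qpow (- 1) - qpow 1) * tv 3 1 * tauv 2),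
     tv 4 2 * tauv 1 - (tauv 1 * tv 4 2 + scal (qpow (- 1) - qpow 1) * tv 4 1 * tauv 2)}"
proof -
  have 1: "{F i |i. i \<in> {a, b}} = {F a, F b}" for F :: "nat \<Rightarrow> cell_gen free_elt" and a b
    by blast
  have 2: "{F i j |i j. i \<in> {a, b} \<and> j \<in> {a', b'}} = {F a a', F a b', F b a', F b b'}"
    for F :: "nat \<Rightarrow> nat \<Rightarrow> cell_gen free_elt" and a b a' b'
    by blast
  show ?thesis
    unfolding cell_rels_def 1 2 by (simp only: Un_insert_left Un_empty_left)
qed

lemma cell_odd_squares: "odd_squares cell_gens cell_par = {tauv 1 * tauv 1, tauv 2 * tauv 2}"
  by (auto simp: odd_squares_def cell_gens_def)

lemma Tgen_in_cell_gens: "i \<in> {3, 4} \<Longrightarrow> j \<in> {1, 2} \<Longrightarrow> Tgen i j \<in> cell_gens"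
  by (auto simp: cell_gens_def)

lemma Taugen_in_cell_gens: "j \<in> {1, 2} \<Longrightarrow> Taugen j \<in> cell_gens"
  by (auto simp: cell_gens_def)

lemma cell_rels_subset: "cell_rels \<subseteq> carrier (free_alg cell_gens)"
  unfolding cell_rels_eq insert_subset
  by (intro conjI free_alg_closed Tgen_in_cell_gens Taugen_in_cell_gens empty_subsetI) simp_all

text \<open>One side is the form for calculation, the other the form for ideals.
  \<open>eq_neg_iff_add_eq_0\<close> accounts for the odd relation, which is encoded with a plus
  sign.\<close>

lemma (in central_scalars) cell_system_iff:
  "cell_system g \<longleftrightarrow> (\<forall>r\<in>odd_squares cell_gens cell_par \<union> cell_rels. ev g r = 0)"
proof -
  show ?thesis
    unfolding cell_rels_eq cell_odd_squares ball_Un ball_simps Set.ball_simps insert_iff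
    by (auto simp: cell_system_def cell_even_def cell_odd_def cell_pair_def ev_diff ev_add ev_mult
        ev_var ev_scal C_diff mult.assoc eq_neg_iff_add_eq_0 simp flip: Q_def simp del: One_nat_def)
qed

abbreviation cell_ideal :: "cell_gen free_elt set" where
  "cell_ideal \<equiv> pres_ideal cell_gens cell_par cell_rels"

abbreviation cell_class :: "cell_gen free_elt \<Rightarrow> cell_gen free_elt set" where
  "cell_class \<equiv> pres_class cell_gens cell_par cell_rels"

abbreviation cell_pres :: "cell_gen free_elt set ring" where
  "cell_pres \<equiv> pres_alg cell_gens cell_par cell_rels"

lemma ideal_cell: "ideal cell_ideal (free_alg cell_gens)"
  by (rule ideal_pres_ideal[OF cell_rels_subset])

lemma cell_class_eq: "cell_class = (+>\<^bsub>free_alg cell_gens\<^esub>) cell_ideal"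
  by (rule ext) (simp add: pres_class_def)

lemma cell_class_hom:
  "ring_hom_ring (free_alg cell_gens) cell_pres cell_class"
  "cell_class ` carrier (free_alg cell_gens) = carrier cell_pres"
  "a_kernel (free_alg cell_gens) cell_pres cell_class = cell_ideal"
  unfolding cell_class_eq pres_alg_def by (rule ring_hom_coset[OF ideal_cell])+

interpretation cell_alg: ring cell_pres
  by (rule ring_hom_ring.axioms(2)[OF cell_class_hom(1)])

interpretation cell_class: ring_hom_ring "free_alg cell_gens" cell_pres cell_class
  by (rule cell_class_hom(1))

section \<open>The presented algebra as a type, and normal forms\<close>

typedef ocell = "carrier cell_pres"
  by blast

setup_lifting type_definition_ocell

instantiation ocell :: "{ring, monoid_mult}"
begin

lift_definition zero_ocell :: ocell is "\<zero>\<^bsub>cell_pres\<^esub>"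
  by (rule cell_alg.zero_closed)
lift_definition one_ocell :: ocell is "\<one>\<^bsub>cell_pres\<^esub>"
  by (rule cell_alg.one_closed)
lift_definition plus_ocell :: "ocell \<Rightarrow> ocell \<Rightarrow> ocell" is "(\<oplus>\<^bsub>cell_pres\<^esub>)"
  by (rule cell_alg.add.m_closed)
lift_definition uminus_ocell :: "ocell \<Rightarrow> ocell" is "a_inv cell_pres"
  by (rule cell_alg.a_inv_closed)
lift_definition minus_ocell :: "ocell \<Rightarrow> ocell \<Rightarrow> ocell" is "a_minus cell_pres"
  by (rule cell_alg.minus_closed)
lift_definition times_ocell :: "ocell \<Rightarrow> ocell \<Rightarrow> ocell" is "(\<otimes>\<^bsub>cell_pres\<^esub>)"
  by (rule cell_alg.m_closed)

instance
  by standard (transfer; rule cell_alg.a_assoc cell_alg.a_comm cell_alg.l_zero cell_alg.l_neg cell_alg.minus_eq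
      cell_alg.m_assoc cell_alg.l_distr cell_alg.r_distr cell_alg.l_one cell_alg.r_one; assumption)+

end

lift_definition ocell_of :: "cell_gen free_elt \<Rightarrow> ocell" is
  "\<lambda>f. if f \<in> carrier (free_alg cell_gens) then cell_class f else \<zero>\<^bsub>cell_pres\<^esub>"
  by simp

definition ocell_scalar :: "laurent \<Rightarrow> ocell" where
  "ocell_scalar c = ocell_of (scal c)"

lemma ocell_of_hom:
  assumes "f \<in> carrier (free_alg cell_gens)" "g \<in> carrier (free_alg cell_gens)"
  shows "ocell_of (f + g) = ocell_of f + ocell_of g" "ocell_of (f * g) = ocell_of f * ocell_of g"
  using assms cell_class.hom_add[OF assms] cell_class.hom_mult[OF assms]
  by (transfer; simp add: free_alg_closed)+

lemma ocell_of_1: "ocell_of 1 = 1"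
  using cell_class.hom_one by transfer (simp add: free_alg_closed)

lemma ocell_of_surj: "\<exists>f\<in>carrier (free_alg cell_gens). x = ocell_of f"
  by transfer (use cell_class_hom(2) in auto)

lemma ocell_of_eq_0_iff:
  assumes "f \<in> carrier (free_alg cell_gens)"
  shows "ocell_of f = 0 \<longleftrightarrow> f \<in> cell_ideal"
proof -
  have "ocell_of f = 0 \<longleftrightarrow> cell_class f = \<zero>\<^bsub>cell_pres\<^esub>"
    using assms by transfer simp
  also have "\<dots> \<longleftrightarrow> f \<in> a_kernel (free_alg cell_gens) cell_pres cell_class"
    unfolding a_kernel_def' using assms by blast
  finally show ?thesis
    by (simp only: cell_class_hom(3))
qed

interpretation ocell: central_scalars ocell_scalar
proof
  fix c x
  obtain f where "f \<in> carrier (free_alg cell_gens)" "x = ocell_of f"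
    using ocell_of_surj by blast
  then show "ocell_scalar c * x = x * ocell_scalar c"
    by (simp add: ocell_scalar_def scal_commute free_alg_closed flip: ocell_of_hom)
qed (simp_all add: ocell_scalar_def scal_1 scal_hom ocell_of_1 ocell_of_hom free_alg_closed)

definition ocell_gen :: "cell_gen \<Rightarrow> ocell" where
  "ocell_gen x = ocell_of (var x)"

lemma ocell_of_eq_ev:
  "f \<in> carrier (free_alg cell_gens) \<Longrightarrow> ocell_of f = ocell.ev ocell_gen f"
  unfolding ocell_gen_def
  by (rule ocell.hom_eq_ev[where X = cell_gens]) (simp_all add: ocell_scalar_def ocell_of_hom)

lemma ocell_system: "ocell.cell_system ocell_gen"
  unfolding ocell.cell_system_iff
proof
  fix r assume r: "r \<in> odd_squares cell_gens cell_par \<union> cell_rels"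
  then have "r \<in> carrier (free_alg cell_gens)"
    using odd_squares_subset cell_rels_subset by blast
  then show "ocell.ev ocell_gen r = 0"
    using rels_in_pres_ideal[OF cell_rels_subset r] ocell_of_eq_0_iff[of r] by (simp add: ocell_of_eq_ev)
qed

text \<open>Ordered monomials in the free algebra act as universal representatives: one coefficient
  family describes the same combination in every ring.\<close>

lemma (in central_scalars) ev_free_lin_comb:
  "ev g (free.lin_comb (free.cell_mono var) c) = lin_comb (cell_mono g) c"
proof -
  have "ev g (free.cell_mono var n) = cell_mono g n" for n
    by (cases n) (simp add: ev_mult ev_power ev_var)
  then show ?thesis
    by (simp add: free.lin_comb_def lin_comb_def ev_sum ev_mult ev_scal)
qed

lemma free_alg_power_closed: "f \<in> carrier (free_alg X) \<Longrightarrow> f ^ n \<in> carrier (free_alg X)"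
  by (induction n) (simp_all add: free_alg_closed)

text \<open>Spanning is obtained in \<open>ocell\<close> and pulled back: the difference evaluates
  to 0 there and hence lies in the ideal.\<close>

lemma cell_normal_form:
  assumes f: "f \<in> carrier (free_alg cell_gens)"
  obtains c where "Poly_Mapping.keys c \<subseteq> cell_index"
    "f - free.lin_comb (free.cell_mono var) c \<in> cell_ideal"
    "free.lin_comb (free.cell_mono var) c \<in> carrier (free_alg cell_gens)"
proof -
  obtain c where c: "ocell.ev ocell_gen f = ocell.lin_comb (ocell.cell_mono ocell_gen) c"
    "Poly_Mapping.keys c \<subseteq> cell_index"
    by (rule ocell.lspan_eq_lin_comb[OF ocell.ev_cell_span[OF ocell_system f]])
  have "free.cell_mono var n \<in> carrier (free_alg cell_gens)" for n
  proof (cases n)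
    case (fields a b f c d e)
    show ?thesis
      unfolding fields free.cell_mono.simps
      by (intro free_alg_closed(4,8) free_alg_power_closed Tgen_in_cell_gens Taugen_in_cell_gens)
        simp_all
  qed
  then have carrier: "free.lin_comb (free.cell_mono var) c \<in> carrier (free_alg cell_gens)"
    unfolding free.lin_comb_def by (intro free_alg_sum_closed free_alg_closed)
  have "ocell_of (f - free.lin_comb (free.cell_mono var) c) = 0"
    unfolding ocell_of_eq_ev[OF free_alg_closed(7)[OF f carrier]] ocell.ev_diff ocell.ev_free_lin_comb c(1)
    by simp
  then have "f - free.lin_comb (free.cell_mono var) c \<in> cell_ideal"
    using ocell_of_eq_0_iff[OF free_alg_closed(7)[OF f carrier]] by blast
  with c(2) show thesis
    using carrier by (rule that)
qed

section \<open>Linear independence of the ordered monomials\<close>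

text \<open>The sum of the leading shifts of the factors of \<open>cell_mono\<close>. The odd
  generators shift the integers exactly as \<open>Tgen 4 2\<close> and \<open>Tgen 4 1\<close> do;
  only the occupation numbers tell them apart.\<close>

fun lead_point :: "nat \<times> nat \<times> nat \<times> nat \<times> nat \<times> nat \<Rightarrow> weyl_point" where
  "lead_point (a, b, f, c, d, e) =
     ((int (b + f), int (a + b + f), int (c + d + e), int (d + e), int (c + d + e)), (f = 1, e = 1))"

text \<open>The booleans recover \<open>f\<close> and \<open>e\<close>, both at most 1; the integers
  then give \<open>b\<close>, \<open>a\<close>, \<open>d\<close> and \<open>c\<close> in
  turn.\<close>

lemma inj_lead_point: "inj_on lead_point cell_index"
  by (auto simp: inj_on_def cell_index_def)

definition vacuum :: "weyl_point \<Rightarrow> laurent" where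
  "vacuum p = (if p = ((0, 0, 0, 0, 0), (False, False)) then 1 else 0)"

lemma weyl_apply_mult: "weyl_apply (S * T) F = weyl_apply S (weyl_apply T F)"
  by (simp add: times_weyl.rep_eq)

lemma weyl_apply_one: "weyl_apply 1 F = F"
  by (simp add: one_weyl.rep_eq)

lemma leading_power:
  assumes F: "leading F (r 0)"
    and step: "\<And>k F. leading F (r k) \<Longrightarrow> leading (weyl_apply T F) (r (Suc k))"
  shows "leading (weyl_apply (T ^ k) F) (r k)"
  by (induction k) (simp_all add: F step weyl_apply_one weyl_apply_mult)

text \<open>The factors act on the vacuum from right to left, so \<open>Taugen 1\<close> meets an
  empty second mode and \<open>Taugen 2\<close> an empty first mode, as the lemmas on their leading
  points demand.\<close>

lemma leading_cell_mono:
  assumes "n \<in> cell_index"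
  shows "leading (weyl_apply (weyl.cell_mono weyl_cell n) vacuum) (lead_point n)"
proof -
  obtain a b f c d e where n: "n = (a, b, f, c, d, e)" "f \<le> 1" "e \<le> 1"
    using assms by (auto simp: cell_index_def)
  let ?T = weyl_cell
  define F0 where "F0 = weyl_apply (?T (Taugen 1) ^ e) vacuum"
  have vac: "leading vacuum ((0, 0, 0, 0, 0), (False, False))"
    by (simp add: leading_def vacuum_def)
  have F0: "leading F0 ((0, 0, int e, int e, int e), (False, e = 1))"
    using leading_Taugen_1[OF vac] vac n(3) unfolding F0_def
    by (cases "e = 0") (simp_all add: weyl_apply_one le_Suc_eq)
  define F1 where "F1 = weyl_apply (?T (Tgen 4 1) ^ d) F0"
  have F1: "leading F1 ((0, 0, int (d + e), int (d + e), int (d + e)), (False, e = 1))"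
    unfolding F1_def
  proof (rule leading_power[where
        r = "\<lambda>d. ((0, 0, int (d + e), int (d + e), int (d + e)), (False, e = 1))"])
    show "leading (weyl_apply (?T (Tgen 4 1)) F)
        ((0, 0, int (Suc k + e), int (Suc k + e), int (Suc k + e)), (False, e = 1))"
      if "leading F ((0, 0, int (k + e), int (k + e), int (k + e)), (False, e = 1))" for k F
      using leading_Tgen_41[OF that] by (simp add: add.commute add.left_commute)
  qed (use F0 in simp)
  define F2 where "F2 = weyl_apply (?T (Tgen 3 1) ^ c) F1"
  have F2: "leading F2 ((0, 0, int (c + d + e), int (d + e), int (c + d + e)), (False, e = 1))"
    unfolding F2_def
  proof (rule leading_power[where
        r = "\<lambda>c. ((0, 0, int (c + d + e), int (d + e), int (c + d + e)), (False, e = 1))"])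
    show "leading (weyl_apply (?T (Tgen 3 1)) F)
        ((0, 0, int (Suc k + d + e), int (d + e), int (Suc k + d + e)), (False, e = 1))"
      if "leading F ((0, 0, int (k + d + e), int (d + e), int (k + d + e)), (False, e = 1))" for k F
      using leading_Tgen_31[OF that] by (simp add: add.commute add.left_commute)
  qed (use F1 in simp)
  define F3 where "F3 = weyl_apply (?T (Taugen 2) ^ f) F2"
  have F3: "leading F3 ((int f, int f, int (c + d + e), int (d + e), int (c + d + e)), (f = 1, e = 1))"
    using leading_Taugen_2[OF F2] F2 n(2) unfolding F3_def
    by (cases "f = 0") (simp_all add: weyl_apply_one le_Suc_eq)
  define F4 where "F4 = weyl_apply (?T (Tgen 4 2) ^ b) F3"
  have F4: "leading F4 ((int (b + f), int (b + f), int (c + d + e), int (d + e), int (c + d + e)), (f = 1, e = 1))"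
    unfolding F4_def
  proof (rule leading_power[where
        r = "\<lambda>b. ((int (b + f), int (b + f), int (c + d + e), int (d + e), int (c + d + e)), (f = 1, e = 1))"])
    show "leading (weyl_apply (?T (Tgen 4 2)) F)
        ((int (Suc k + f), int (Suc k + f), int (c + d + e), int (d + e), int (c + d + e)), (f = 1, e = 1))"
      if "leading F ((int (k + f), int (k + f), int (c + d + e), int (d + e), int (c + d + e)), (f = 1, e = 1))"
      for k F
      using leading_Tgen_42[OF that] by (simp add: add.commute add.left_commute)
  qed (use F3 in simp)
  have "leading (weyl_apply (?T (Tgen 3 2) ^ a) F4)
      ((int (b + f), int (a + b + f), int (c + d + e), int (d + e), int (c + d + e)), (f = 1, e = 1))"
  proof (rule leading_power[where
        r = "\<lambda>a. ((int (b + f), int (a + b + f), int (c + d + e), int (d + e), int (c + d + e)), (f = 1, e = 1))"])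
    show "leading (weyl_apply (?T (Tgen 3 2)) F)
        ((int (b + f), int (Suc k + b + f), int (c + d + e), int (d + e), int (c + d + e)), (f = 1, e = 1))"
      if "leading F ((int (b + f), int (k + b + f), int (c + d + e), int (d + e), int (c + d + e)), (f = 1, e = 1))"
      for k F
      using leading_Tgen_32[OF that] by (simp add: add.commute add.left_commute)
  qed (use F4 in simp)
  then show ?thesis
    by (simp add: n weyl_apply_mult F4_def F3_def F2_def F1_def F0_def del: One_nat_def)
qed

lemma weyl_apply_lin_comb:
  "weyl_apply (weyl.lin_comb N c) F p =
     (\<Sum>n\<in>Poly_Mapping.keys c. Poly_Mapping.lookup c n * weyl_apply (N n) F p)"
proof -
  have "weyl_apply (\<Sum>n\<in>A. weyl_scalar (Poly_Mapping.lookup c n) * N n) F p =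
      (\<Sum>n\<in>A. Poly_Mapping.lookup c n * weyl_apply (N n) F p)" if "finite A" for A
    using that by induction
      (simp_all add: zero_weyl.rep_eq plus_weyl.rep_eq weyl_apply_mult weyl_scalar.rep_eq)
  then show ?thesis
    by (simp add: weyl.lin_comb_def)
qed

text \<open>The combination is evaluated at the lead point of a monomial of maximal height. Any
  other monomial vanishes there, since the point differs from its own lead point and is at least as
  high. The surviving product is 0, and \<open>laurent\<close> has no zero divisors.\<close>

lemma weyl_cell_mono_independent:
  assumes keys: "Poly_Mapping.keys c \<subseteq> cell_index"
    and zero: "weyl.lin_comb (weyl.cell_mono weyl_cell) c = 0"
  shows "c = 0"
proof (rule ccontr)
  assume "c \<noteq> 0"
  then have ne: "Poly_Mapping.keys c \<noteq> {}" by simp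
  have "\<exists>m\<in>Poly_Mapping.keys c. \<forall>n\<in>Poly_Mapping.keys c. height (lead_point n) \<le> height (lead_point m)"
  proof -
    have "Max ((\<lambda>n. height (lead_point n)) ` Poly_Mapping.keys c)
        \<in> (\<lambda>n. height (lead_point n)) ` Poly_Mapping.keys c"
      using ne by (intro Max_in) auto
    then obtain m where "m \<in> Poly_Mapping.keys c"
      "height (lead_point m) = Max ((\<lambda>n. height (lead_point n)) ` Poly_Mapping.keys c)"
      by auto
    then show ?thesis
      by (intro bexI[of _ m]) auto
  qed
  then obtain m where m: "m \<in> Poly_Mapping.keys c"
    "\<And>n. n \<in> Poly_Mapping.keys c \<Longrightarrow> height (lead_point n) \<le> height (lead_point m)"
    by blast
  let ?v = "\<lambda>n. weyl_apply (weyl.cell_mono weyl_cell n) vacuum (lead_point m)"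
  have other: "?v n = 0" if "n \<in> Poly_Mapping.keys c" "n \<noteq> m" for n
  proof -
    have "lead_point m \<noteq> lead_point n"
      using inj_onD[OF inj_lead_point, of m n] that m(1) keys by blast
    moreover have "height (lead_point n) \<le> height (lead_point m)"
      using m(2) that(1) by blast
    moreover have "leading (weyl_apply (weyl.cell_mono weyl_cell n) vacuum) (lead_point n)"
      using that(1) keys by (intro leading_cell_mono) blast
    ultimately show ?thesis
      unfolding leading_def by blast
  qed
  have "0 = weyl_apply (weyl.lin_comb (weyl.cell_mono weyl_cell) c) vacuum (lead_point m)"
    by (simp add: zero zero_weyl.rep_eq)
  also have "\<dots> = (\<Sum>n\<in>Poly_Mapping.keys c. Poly_Mapping.lookup c n * ?v n)"
    by (rule weyl_apply_lin_comb)
  also have "\<dots> = Poly_Mapping.lookup c m * ?v m"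
    using m(1) other by (subst sum.remove[of _ m]) (auto intro!: sum.neutral)
  finally have "Poly_Mapping.lookup c m * ?v m = 0" by simp
  moreover have "leading (weyl_apply (weyl.cell_mono weyl_cell m) vacuum) (lead_point m)"
    using m(1) keys by (intro leading_cell_mono) blast
  ultimately have "Poly_Mapping.lookup c m = 0"
    by (simp add: leading_def)
  with m(1) show False
    by (simp add: in_keys_iff)
qed

section \<open>The isomorphism\<close>

lemma free_part_sum:
  "(\<And>i. i \<in> S \<Longrightarrow> f i \<in> free_part X par k) \<Longrightarrow> (\<Sum>i\<in>S. f i) \<in> free_part X par k"
  by (induction S rule: infinite_finite_induct) (simp_all add: free_part_add)

lemma free_part_diff:
  "f \<in> free_part X par k \<Longrightarrow> g \<in> free_part X par k \<Longrightarrow> f - g \<in> free_part X par k"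
  using free_part_add[of f X par k "- g"] free_part_uminus[of g X par k] by simp

lemma free_part_subset: "free_part X par k \<subseteq> carrier (free_alg X)"
  by (auto simp: free_part_def)

lemma free_part_ev:
  assumes u: "\<And>x. x \<in> X \<Longrightarrow> u x \<in> free_part Y par' (par x)"
    and f: "f \<in> free_part X par k"
  shows "free.ev u f \<in> free_part Y par' k"
proof -
  have word: "prod_list (map u l) \<in> free_part Y par' (sum_list (map par l))" if "set l \<subseteq> X" for l
    using that
  proof (induction l)
    case Nil
    then show ?case using free_part_scal[of 1] by (simp add: scal_1)
  qed (simp add: free_part_mult u)
  have "scal c * prod_list (map u (letters w)) \<in> free_part Y par' k" if "w \<in> Poly_Mapping.keys f" for w c
  proof -
    have w: "set (letters w) \<subseteq> X" "sum_list (map par (letters w)) mod 2 = k mod 2"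
      using f that by (simp_all add: free_part_iff)
    show ?thesis
      by (rule free_part_cong[OF free_part_mult[OF free_part_scal word[OF w(1)]]]) (simp add: w(2))
  qed
  then show ?thesis
    unfolding free.ev_def free.lin_comb_def by (intro free_part_sum)
qed

lemma free_part_ent:
  "i \<in> {1..5} \<Longrightarrow> j \<in> {1..5} \<Longrightarrow> ent i j \<in> free_part gl_gens gl_par (idx_par i + idx_par j)"
  by (rule free_part_cong[OF free_part_var]) simp_all

lemma free_part_qminor:
  assumes "i \<in> {1..4}" "j \<in> {1..5}"
  shows "qminor i j \<in> free_part gl_gens gl_par (idx_par j)"
proof -
  have "idx_par i = 0" "idx_par 1 = 0" "idx_par 2 = 0"
    using assms(1) by (simp_all add: idx_par_def)
  moreover have "i \<in> {1..5}"
    using assms(1) by simp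
  ultimately have e: "ent i 1 \<in> free_part gl_gens gl_par 0" "ent i 2 \<in> free_part gl_gens gl_par 0"
    "ent j 1 \<in> free_part gl_gens gl_par (idx_par j)" "ent j 2 \<in> free_part gl_gens gl_par (idx_par j)"
    using free_part_ent[of i 1] free_part_ent[of i 2] free_part_ent[of j 1] free_part_ent[of j 2] assms(2)
    by simp_all
  have "scal (qpow (- 1)) * ent i 2 * ent j 1 \<in> free_part gl_gens gl_par (0 + 0 + idx_par j)"
    by (intro free_part_mult free_part_scal e)
  moreover have "ent i 1 * ent j 2 \<in> free_part gl_gens gl_par (0 + idx_par j)"
    by (intro free_part_mult e)
  ultimately show ?thesis
    unfolding qminor_def by (intro free_part_diff) simp_all
qed

lemma free_part_qminor12_inv: "qminor12_inv \<in> free_part gl_gens gl_par 0"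
proof -
  have e: "ent i j \<in> free_part gl_gens gl_par 0" if "i \<in> {3, 4}" "j \<in> {3, 4}" for i j
    using free_part_ent[of i j] that by (auto simp: idx_par_def)
  have d: "var Det1inv \<in> free_part gl_gens gl_par 0"
    using free_part_var[of Det1inv gl_gens gl_par] by (simp add: gl_gens_def)
  have m: "f * g \<in> free_part gl_gens gl_par 0"
    if "f \<in> free_part gl_gens gl_par 0" "g \<in> free_part gl_gens gl_par 0" for f g
    using free_part_mult[OF that] by simp
  show ?thesis
    unfolding qminor12_inv_def by (intro m free_part_diff e d free_part_scal) simp_all
qed

lemma free_part_coord_lift:
  assumes "i \<in> {3, 4, 5}"
  shows "coord_lift i j \<in> free_part gl_gens gl_par (idx_par i)"
proof -
  have i: "i \<in> {1..5}" using assms by auto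
  have "- scal (qpow (- 1)) * qminor 2 i \<in> free_part gl_gens gl_par (0 + idx_par i)"
    using i by (intro free_part_mult free_part_uminus free_part_scal free_part_qminor) auto
  moreover have "qminor 1 i \<in> free_part gl_gens gl_par (idx_par i)"
    using i by (intro free_part_qminor) auto
  ultimately show ?thesis
    unfolding coord_lift_def using free_part_mult[OF _ free_part_qminor12_inv] by force
qed

lemma free_part_cell_lift:
  assumes "x \<in> cell_gens"
  shows "cell_lift x \<in> free_part gl_gens gl_par (cell_par x)"
  using assms free_part_coord_lift[of 3] free_part_coord_lift[of 4] free_part_coord_lift[of 5]
  by (auto simp: cell_gens_def idx_par_def)

lemma free_part_lift:
  "f \<in> free_part cell_gens cell_par k \<Longrightarrow> free.ev cell_lift f \<in> free_part gl_gens gl_par k"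
  by (rule free_part_ev[OF free_part_cell_lift])

lemma cell_lift_closed: "x \<in> cell_gens \<Longrightarrow> cell_lift x \<in> carrier (free_alg gl_gens)"
  using free_part_cell_lift free_part_subset by blast

lemma lift_closed:
  "f \<in> carrier (free_alg cell_gens) \<Longrightarrow> free.ev cell_lift f \<in> carrier (free_alg gl_gens)"
  by (induction rule: free_alg_induct)
    (simp_all add: free.ev_scal free.ev_var free.ev_add free.ev_mult free_alg_closed cell_lift_closed)

text \<open>The computation takes place in \<open>opar\<close>; its outcome is moved back to the
  record \<open>O_P\<close>, where uniqueness of inverses determines \<open>inv\<close>.\<close>

lemma to_P_qminor12_inverse: "inv\<^bsub>O_P\<^esub> to_P (qminor 1 2) = to_P qminor12_inv"
proof -
  have closed: "qminor 1 2 \<in> carrier (free_alg gl_gens)" "qminor12_inv \<in> carrier (free_alg gl_gens)"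
    using free_part_qminor[of 1 2] free_part_qminor12_inv free_part_subset by auto
  have "opar_of (qminor 1 2) = ominor12" "opar_of qminor12_inv = ominor12_inv"
    by (simp_all only: opar_of_eq_ev closed opar.ev_qminor opar.ev_qminor12_inv ominor12_inv_def)
  then have "opar_of (qminor 1 2 * qminor12_inv) = opar_of 1" "opar_of (qminor12_inv * qminor 1 2) = opar_of 1"
    by (simp_all only: opar_of_hom closed opar_of_1 ominor12_inverse)
  then have "to_P (qminor 1 2 * qminor12_inv) = to_P 1" "to_P (qminor12_inv * qminor 1 2) = to_P 1"
    by (simp_all only: opar_of_eq_iff free_alg_closed closed)
  moreover have "to_P 1 = \<one>\<^bsub>O_P\<^esub>"
    using to_P.hom_one by simp
  ultimately have "to_P (qminor 1 2) \<otimes>\<^bsub>O_P\<^esub> to_P qminor12_inv = \<one>\<^bsub>O_P\<^esub>"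
    "to_P qminor12_inv \<otimes>\<^bsub>O_P\<^esub> to_P (qminor 1 2) = \<one>\<^bsub>O_P\<^esub>"
    using to_P.hom_mult[OF closed] to_P.hom_mult[OF closed(2,1)] by simp_all
  then show ?thesis
    using O_P.inv_unique'[OF to_P.hom_closed[OF closed(1)] to_P.hom_closed[OF closed(2)]] by simp
qed

lemma cell_coord_eq:
  assumes "i \<in> {3, 4, 5}"
  shows "cell_coord i j = to_P (coord_lift i j)"
proof -
  have "i \<in> {1..5}" using assms by auto
  then have q: "qminor 1 i \<in> carrier (free_alg gl_gens)" "qminor 2 i \<in> carrier (free_alg gl_gens)"
    using free_part_qminor[of 1 i] free_part_qminor[of 2 i] free_part_subset by auto
  have inv: "qminor12_inv \<in> carrier (free_alg gl_gens)"
    using free_part_qminor12_inv free_part_subset by blast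
  have "- scal (qpow (- 1)) * qminor 2 i \<in> carrier (free_alg gl_gens)"
    using q by (intro free_alg_closed)
  then show ?thesis
    using to_P.hom_mult[OF _ inv] q(1)
    by (simp add: cell_coord_def coord_lift_def to_P_qminor12_inverse del: One_nat_def)
qed

lemma big_cell_elt_eq: "x \<in> cell_gens \<Longrightarrow> big_cell_elt x = to_P (cell_lift x)"
  by (auto simp: cell_gens_def cell_coord_eq)

section \<open>The surjection from the free algebra onto the big cell and its kernel\<close>

definition cell_hom :: "cell_gen free_elt \<Rightarrow> gl_gen free_elt set set" where
  "cell_hom f = to_P (free.ev cell_lift f)"

lemma cell_hom_hom:
  assumes "f \<in> carrier (free_alg cell_gens)" "g \<in> carrier (free_alg cell_gens)"
  shows "cell_hom (f + g) = cell_hom f \<oplus>\<^bsub>O_P\<^esub> cell_hom g"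
    "cell_hom (f * g) = cell_hom f \<otimes>\<^bsub>O_P\<^esub> cell_hom g"
  using to_P.hom_add[OF lift_closed[OF assms(1)] lift_closed[OF assms(2)]]
    to_P.hom_mult[OF lift_closed[OF assms(1)] lift_closed[OF assms(2)]]
  by (simp_all add: cell_hom_def free.ev_add free.ev_mult)

lemma cell_hom_scal: "cell_hom (scal c) = to_P (scal c)"
  by (simp add: cell_hom_def free.ev_scal)

lemma cell_hom_var: "x \<in> cell_gens \<Longrightarrow> cell_hom (var x) = big_cell_elt x"
  by (simp add: cell_hom_def free.ev_var big_cell_elt_eq)

lemma cell_hom_one: "cell_hom 1 = \<one>\<^bsub>O_P\<^esub>"
  using to_P.hom_one by (simp add: cell_hom_def)

lemma O_U12_gens_subset: "range (\<lambda>c. to_P (scal c)) \<union> big_cell_elt ` cell_gens \<subseteq> carrier O_P"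
  by (auto simp: big_cell_elt_eq intro!: to_P.hom_closed free_alg_closed cell_lift_closed)

lemma ring_O_U12: "ring O_U12"
  unfolding O_U12_def by (rule O_P.generate_ring_is_ring[OF O_U12_gens_subset])

lemma cell_hom_image: "cell_hom ` carrier (free_alg cell_gens) = carrier O_U12"
proof -
  let ?G = "range (\<lambda>c. to_P (scal c)) \<union> big_cell_elt ` cell_gens"
  have "cell_hom f \<in> generate_ring O_P ?G" if "f \<in> carrier (free_alg cell_gens)" for f
    using that
  proof (induction rule: free_alg_induct)
    case (scal c)
    show ?case unfolding cell_hom_scal by (rule generate_ring.incl) blast
  next
    case (var x)
    then show ?case unfolding cell_hom_var[OF var] by (intro generate_ring.incl) blast
  next
    case (add f g)
    then show ?case unfolding cell_hom_hom(1)[OF add(1,2)] by (intro generate_ring.eng_add)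
  next
    case (mult f g)
    then show ?case unfolding cell_hom_hom(2)[OF mult(1,2)] by (intro generate_ring.eng_mult)
  qed
  moreover have "\<exists>f\<in>carrier (free_alg cell_gens). x = cell_hom f" if "x \<in> generate_ring O_P ?G" for x
    using that
  proof induction
    case one
    show ?case
      by (rule bexI[of _ 1]) (simp_all add: cell_hom_one free_alg_closed)
  next
    case (incl h)
    then consider c where "h = to_P (scal c)" | x where "x \<in> cell_gens" "h = big_cell_elt x"
      by blast
    then show ?case
    proof cases
      case 1
      show ?thesis
        by (rule bexI[of _ "scal c"]) (simp_all add: 1 cell_hom_scal free_alg_closed)
    next
      case 2
      show ?thesis
        by (rule bexI[of _ "var x"]) (simp_all only: 2 cell_hom_var free_alg_closed)
    qed
  next
    case (a_inv h)
    then obtain f where f: "f \<in> carrier (free_alg cell_gens)" "h = cell_hom f" by blast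
    have "cell_hom (- f) = \<ominus>\<^bsub>O_P\<^esub> h"
      unfolding cell_hom_def f(2) free.ev_minus
      using to_P.hom_a_inv[OF lift_closed[OF f(1)]] free_alg_a_inv[OF lift_closed[OF f(1)]]
      by (simp only:)
    then show ?case
      using free_alg_closed(5)[OF f(1)] by (intro bexI[of _ "- f"]) simp_all
  next
    case (eng_add h1 h2)
    then obtain f g where fg: "f \<in> carrier (free_alg cell_gens)" "h1 = cell_hom f"
      "g \<in> carrier (free_alg cell_gens)" "h2 = cell_hom g" by blast
    show ?case
      unfolding fg(2,4) cell_hom_hom(1)[OF fg(1,3), symmetric]
      using free_alg_closed(6)[OF fg(1,3)] by blast
  next
    case (eng_mult h1 h2)
    then obtain f g where fg: "f \<in> carrier (free_alg cell_gens)" "h1 = cell_hom f"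
      "g \<in> carrier (free_alg cell_gens)" "h2 = cell_hom g" by blast
    show ?case
      unfolding fg(2,4) cell_hom_hom(2)[OF fg(1,3), symmetric]
      using free_alg_closed(8)[OF fg(1,3)] by blast
  qed
  moreover have "carrier O_U12 = generate_ring O_P ?G"
    by (simp add: O_U12_def)
  ultimately show ?thesis
    by blast
qed

lemma cell_hom_ring_hom: "ring_hom_ring (free_alg cell_gens) O_U12 cell_hom"
proof (rule ring_hom_ringI2[OF ring_free_alg ring_O_U12], rule ring_hom_memI)
  show "cell_hom f \<in> carrier O_U12" if "f \<in> carrier (free_alg cell_gens)" for f
    using that cell_hom_image by blast
qed (simp_all add: O_U12_def cell_hom_hom cell_hom_one)

lemma cell_hom_eq_zero_iff:
  assumes "f \<in> carrier (free_alg cell_gens)"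
  shows "cell_hom f = \<zero>\<^bsub>O_P\<^esub> \<longleftrightarrow> opar.ev opar_cell f = 0"
proof -
  have "opar_of (free.ev cell_lift f) = opar.ev opar_cell f"
    unfolding opar_cell_def using assms by (simp add: opar_of_eq_ev lift_closed opar.ev_free_ev)
  then show ?thesis
    using opar_of_eq_0_iff[OF lift_closed[OF assms]] by (simp add: cell_hom_def)
qed

lemma cell_ideal_subset_kernel:
  assumes "f \<in> cell_ideal"
  shows "cell_hom f = \<zero>\<^bsub>O_P\<^esub>"
proof -
  have f: "f \<in> carrier (free_alg cell_gens)"
    using ideal.Icarr[OF ideal_cell assms] .
  have rels: "opar.ev opar_cell r = 0" if "r \<in> odd_squares cell_gens cell_par \<union> cell_rels" for r
    using opar_cell_system that unfolding opar.cell_system_iff by blast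
  have odd: "opar_cell x * opar_cell x = 0" if "x \<in> cell_gens" "odd (cell_par x)" for x
  proof -
    have "var x * var x \<in> odd_squares cell_gens cell_par"
      using that unfolding odd_squares_def by blast
    then show ?thesis
      using rels[of "var x * var x"] by (simp add: opar.ev_mult opar.ev_var)
  qed
  have "opar.ev opar_cell f = 0"
    using odd rels cell_rels_subset assms by (rule opar.ev_pres_ideal) blast+
  then show ?thesis
    by (simp add: cell_hom_eq_zero_iff f)
qed

lemma weyl_cell_lift: "x \<in> cell_gens \<Longrightarrow> weyl.ev weyl_gen (cell_lift x) = weyl_cell x"
  by (auto simp: cell_gens_def weyl.ev_coord_lift weyl.ev_qminor12_inv weyl_minor_34 simp del: One_nat_def
      weyl_gen.simps(2))

text \<open>\<open>f\<close> may be replaced by its normal form, since their difference lies in the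
  ideal, which is already known to be killed. If the normal form dies in \<open>O_P\<close>, it dies
  as an operator, and independence makes all its coefficients 0.\<close>

lemma kernel_subset_cell_ideal:
  assumes f: "f \<in> carrier (free_alg cell_gens)" and zero: "cell_hom f = \<zero>\<^bsub>O_P\<^esub>"
  shows "f \<in> cell_ideal"
proof -
  obtain c where c: "Poly_Mapping.keys c \<subseteq> cell_index"
    "f - free.lin_comb (free.cell_mono var) c \<in> cell_ideal"
    "free.lin_comb (free.cell_mono var) c \<in> carrier (free_alg cell_gens)"
    by (rule cell_normal_form[OF f])
  let ?f' = "free.lin_comb (free.cell_mono var) c"
  have "opar.ev opar_cell (f - ?f') = 0"
    using cell_ideal_subset_kernel[OF c(2)] cell_hom_eq_zero_iff[OF free_alg_closed(7)[OF f c(3)]]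
    by blast
  moreover have "opar.ev opar_cell f = 0"
    using zero cell_hom_eq_zero_iff[OF f] by blast
  ultimately have "opar.ev opar_cell ?f' = 0"
    by (simp add: opar.ev_diff)
  then have "to_P (free.ev cell_lift ?f') = \<zero>\<^bsub>O_P\<^esub>"
    using cell_hom_eq_zero_iff[OF c(3)] unfolding cell_hom_def by blast
  with weyl_kills lift_closed[OF c(3)] have "weyl.ev weyl_gen (free.ev cell_lift ?f') = 0"
    by (rule weyl.ev_eq_zero_if_to_P_eq_zero)
  then have "weyl.ev weyl_cell ?f' = 0"
    using weyl.ev_free_ev[OF c(3), of weyl_gen cell_lift] weyl.ev_cong[OF c(3) weyl_cell_lift] by (simp only:)
  then have "c = 0"
    unfolding weyl.ev_free_lin_comb by (rule weyl_cell_mono_independent[OF c(1)])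
  with c(2) show ?thesis by simp
qed

lemma cell_hom_kernel: "a_kernel (free_alg cell_gens) O_U12 cell_hom = cell_ideal"
proof -
  have zero: "\<zero>\<^bsub>O_U12\<^esub> = \<zero>\<^bsub>O_P\<^esub>"
    by (simp add: O_U12_def)
  show ?thesis
    unfolding a_kernel_def' zero
    using cell_ideal_subset_kernel kernel_subset_cell_ideal ideal.Icarr[OF ideal_cell] by blast
qed

theorem proposition7p4:
  shows "\<exists>\<phi>.
    \<phi> \<in> ring_iso (pres_alg cell_gens cell_par cell_rels) O_U12 \<and>
    (\<forall>c. \<phi> (pres_class cell_gens cell_par cell_rels (scal c)) = to_P (scal c)) \<and>
    (\<forall>x \<in> cell_gens. \<phi> (pres_class cell_gens cell_par cell_rels (var x)) = big_cell_elt x) \<and>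
    (\<forall>k. \<phi> ` pres_class cell_gens cell_par cell_rels ` free_part cell_gens cell_par k
         \<subseteq> to_P ` free_part gl_gens gl_par k)"
proof (intro exI conjI allI ballI)
  interpret ring_hom_ring "free_alg cell_gens" O_U12 cell_hom
    by (rule cell_hom_ring_hom)
  \<comment> \<open>\<open>cell_hom\<close> is constant on the cosets of its kernel, so the image of
    a coset is a singleton; \<open>FactRing_iso_set\<close> is the first isomorphism theorem for
    this map.\<close>
  let ?\<phi> = "\<lambda>X. the_elem (cell_hom ` X)"
  show "?\<phi> \<in> ring_iso (pres_alg cell_gens cell_par cell_rels) O_U12"
    using FactRing_iso_set[OF cell_hom_image] unfolding cell_hom_kernel pres_alg_def .
  have \<phi>: "?\<phi> (cell_class f) = cell_hom f" if "f \<in> carrier (free_alg cell_gens)" for f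
    using the_elem_simp[OF that] unfolding cell_hom_kernel cell_class_eq .
  show "?\<phi> (cell_class (scal c)) = to_P (scal c)" for c
    by (simp add: \<phi> free_alg_closed cell_hom_scal)
  show "?\<phi> (cell_class (var x)) = big_cell_elt x" if "x \<in> cell_gens" for x
    using that by (simp add: \<phi> free_alg_closed cell_hom_var)
  show "?\<phi> ` cell_class ` free_part cell_gens cell_par k \<subseteq> to_P ` free_part gl_gens gl_par k" for k
  proof clarify
    fix f assume f: "f \<in> free_part cell_gens cell_par k"
    then have "f \<in> carrier (free_alg cell_gens)"
      using free_part_subset by blast
    from \<phi>[OF this] have "?\<phi> (cell_class f) = to_P (free.ev cell_lift f)"
      unfolding cell_hom_def .
    with free_part_lift[OF f] show "?\<phi> (cell_class f) \<in> to_P ` free_part gl_gens gl_par k"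
      by blast
  qed
qed

end
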